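(* Let $\mathbb{D}$ be a double category with cofolding. If the horizontal 2-category $\mathbf{H}\mathbb{D}$ admits the construction of free monads (as a 2-category), then the double category $\mathbb{D}$ admits the construction of free monads (as a double category). That is: if the forgetful 2-functor $\mathrm{Mnd}(\mathbf{H}\mathbb{D})\to\mathrm{End}(\mathbf{H}\mathbb{D})$ has a right 2-adjoint with a counit each of whose components $\varepsilon_{(Y,Q)}$ has underlying horizontal morphism $1^h_Y$, then the forgetful double functor $U\colon\mathbb{M}\mathrm{nd}(\mathbb{D})\to\mathbb{E}\mathrm{nd}(\mathbb{D})$ has a vertical left double adjoint $R$ with a unit $\eta$ such that the underlying vertical morphism in $\mathbb{D}$ of each unit component $\eta_{(Y,Q)}\colon (Y,Q)\to UR(Y,Q)$ is $1^v_Y$.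
   Context: **Double categories.** Double categories are strict (internal categories in $\mathbf{Cat}$): objects, horizontal morphisms, vertical morphisms, squares. $[\alpha\ \beta]$ denotes horizontal composition of squares ($\alpha$ on the left; for horizontal morphisms $[f\ g]=g\circ f$) and $\begin{bmatrix}\alpha\\ \beta\end{bmatrix}$ vertical composition ($\alpha$ on top). $1^h_C,1^v_C$ are identity horizontal/vertical morphisms, $i^h_j$ is the horizontal identity square of a vertical morphism $j$, $i^v_f$ the vertical identity square of a horizontal morphism $f$. The horizontal 2-category $\mathbf{H}\mathbb{D}$ has the objects and horizontal morphisms of $\mathbb{D}$, and as 2-cells (from top to bottom) the squares whose left and right sides are vertical identities. **Vertical double adjunction.** This is an adjunction in the 2-category of double categories, double functors and vertical natural transformations. A vertical natural transformation $\sigma\colon F\Rightarrow G$ assigns to each object $A$ a vertical morphism $\sigma_A\colon FA\to GA$ and to each horizontal morphism $f\colon A\to B$ a square $\sigma_f$ with top $Ff$, bottom $Gf$, left $\sigma_A$, right $\sigma_B$, compatibly with horizontal composition and identities, such that $\begin{bmatrix}F\alpha\\ \sigma_g\end{bmatrix}=\begin{bmatrix}\sigma_f\\ G\alpha\end{bmatrix}$ for each square $\alpha$ with top $f$ and bottom $g$. **Cofolding.** For a 2-category $\mathbf{K}$, the double category of inverse quintets $\overline{\mathbb{Q}}\mathbf{K}$ has the objects of $\mathbf{K}$; its horizontal 1-category is the underlying 1-category of $\mathbf{K}$; its vertical 1-category is the opposite of that; squares with top $f\colon A\to B$, bottom $g\colon C\to D$, left $j^{op}$ ($j\colon C\to A$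 in $\mathbf{K}$), right $k^{op}$ ($k\colon D\to B$ in $\mathbf{K}$) are 2-cells $f\circ j\Rightarrow k\circ g$ in $\mathbf{K}$, composed by pasting. A cofolding on $\mathbb{D}$ is a double functor $\Lambda\colon\mathbb{D}\to\overline{\mathbb{Q}}\mathbf{H}\mathbb{D}$ which is the identity on $\mathbf{H}\mathbb{D}$ and fully faithful (bijective for each fixed boundary) on squares. Explicitly it sends a vertical morphism $j\colon A\to C$ functorially to a horizontal morphism $j^*\colon C\to A$, and gives bijections between squares $\alpha$ with top $f$, bottom $g$, left $j$, right $k$, and 2-cells $\Lambda(\alpha)\colon [j^*\ f]\Rightarrow[g\ k^*]$ in $\mathbf{H}\mathbb{D}$, compatible with both compositions and identities. **Endomorphisms and monads.** An endomorphism $(X,P)$ in $\mathbb{D}$ is an object $X$ with a horizontal morphism $P\colon X\to X$. A monad is an endomorphism with 2-cells $\mu_P\colon[P\ P]\Rightarrow P$, $\eta_P\colon 1^h_X\Rightarrow P$ of $\mathbf{H}\mathbb{D}$ satisfying associativity and unit laws. A horizontal endomorphism map $(F,\phi)\colon(X,P)\to(Y,Q)$ is a horizontal morphism $F\colon X\to Y$ with a 2-cell $\phi\colon[F\ Q]\Rightarrow[P\ F]$ of $\mathbf{H}\mathbb{D}$. It is a horizontal monad map if $\begin{bmatrix}[i^v_F\ \eta_Q]\\ \phi\end{bmatrix}=[\eta_P\ i^v_F]$ and $\begin{bmatrix}[i^v_F\ \mu_Q]\\ \phi\end{bmatrix}=\begin{bmatrix}[\phi\ i^v_Q]\\ [i^v_P\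 \phi]\\ [\mu_P\ i^v_F]\end{bmatrix}$. A vertical endomorphism map $(u,\bar u)\colon(X,P)\to(X',P')$ is a vertical morphism $u\colon X\to X'$ with a square $\bar u$ with top $P$, bottom $P'$, left and right $u$. It is a vertical monad map if $\begin{bmatrix}\eta_P\\ \bar u\end{bmatrix}=\begin{bmatrix}i^h_u\\ \eta_{P'}\end{bmatrix}$ and $\begin{bmatrix}\mu_P\\ \bar u\end{bmatrix}=\begin{bmatrix}[\bar u\ \bar u]\\ \mu_{P'}\end{bmatrix}$. A square (endomorphism square or monad square) with top $(F,\phi)$, bottom $(F',\phi')$, left $(u,\bar u)$, right $(v,\bar v)$ is a square $\alpha$ of $\mathbb{D}$ with top $F$, bottom $F'$, left $u$, right $v$ such that $\begin{bmatrix}\phi\\ [\bar u\ \alpha]\end{bmatrix}=\begin{bmatrix}[\alpha\ \bar v]\\ \phi'\end{bmatrix}$. These form double categories $\mathbb{E}\mathrm{nd}(\mathbb{D})$ and $\mathbb{M}\mathrm{nd}(\mathbb{D})$, with forgetful double functor $U\colon\mathbb{M}\mathrm{nd}(\mathbb{D})\to\mathbb{E}\mathrm{nd}(\mathbb{D})$. Their horizontal 2-categories depend only on $\mathbf{H}\mathbb{D}$ and are Street's 2-categories $\mathrm{End}(\mathbf{H}\mathbb{D})$ and $\mathrm{Mnd}(\mathbf{H}\mathbb{D})$. **Free monads.** A 2-category $\mathbf{K}$ admits the construction of free monads if the forgetful 2-functor $\mathrm{Mnd}(\mathbf{K})\to\mathrm{End}(\mathbf{K})$ has a right 2-adjoint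 with a counit such that the underlying morphism in $\mathbf{K}$ of each counit component at $(Y,Q)$ is $1_Y$. A double category $\mathbb{D}$ admits the construction of free monads if $U$ has a vertical left double adjoint $R$ with a unit $\eta$ such that the underlying vertical morphism of each $\eta_{(Y,Q)}$ is $1^v_Y$. *)

theory Defs
  imports Main
begin

text \<open>
  Structures have explicit carriers, and all equations are required on the carriers only.
  Every composition is written in diagrammatic order: the first factor is the left one of a
  horizontal composite and the upper one of a vertical composite.
\<close>

locale category =
  fixes Ob :: "'o set" and Mor :: "'m set"
    and dom cod :: "'m \<Rightarrow> 'o" and ide :: "'o \<Rightarrow> 'm" and comp :: "'m \<Rightarrow> 'm \<Rightarrow> 'm"
  assumes dom_closed: "f \<in> Mor \<Longrightarrow> dom f \<in> Ob"
    and cod_closed: "f \<in> Mor \<Longrightarrow> cod f \<in> Ob"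
    and ide_closed: "A \<in> Ob \<Longrightarrow> ide A \<in> Mor"
    and dom_ide: "A \<in> Ob \<Longrightarrow> dom (ide A) = A"
    and cod_ide: "A \<in> Ob \<Longrightarrow> cod (ide A) = A"
    and comp_closed: "\<lbrakk>f \<in> Mor; g \<in> Mor; cod f = dom g\<rbrakk> \<Longrightarrow> comp f g \<in> Mor"
    and dom_comp: "\<lbrakk>f \<in> Mor; g \<in> Mor; cod f = dom g\<rbrakk> \<Longrightarrow> dom (comp f g) = dom f"
    and cod_comp: "\<lbrakk>f \<in> Mor; g \<in> Mor; cod f = dom g\<rbrakk> \<Longrightarrow> cod (comp f g) = cod g"
    and ide_comp: "f \<in> Mor \<Longrightarrow> comp (ide (dom f)) f = f"
    and comp_ide: "f \<in> Mor \<Longrightarrow> comp f (ide (cod f)) = f"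
    and comp_assoc: "\<lbrakk>f \<in> Mor; g \<in> Mor; h \<in> Mor; cod f = dom g; cod g = dom h\<rbrakk>
          \<Longrightarrow> comp (comp f g) h = comp f (comp g h)"


section \<open>2-categories\<close>

record ('o, 'm, 'c) twocat =
  Cell0 :: "'o set"
  Cell1 :: "'m set"
  Cell2 :: "'c set"
  dom1 :: "'m \<Rightarrow> 'o"
  cod1 :: "'m \<Rightarrow> 'o"
  src2 :: "'c \<Rightarrow> 'm"
  tgt2 :: "'c \<Rightarrow> 'm"
  id1 :: "'o \<Rightarrow> 'm"
  id2 :: "'m \<Rightarrow> 'c"
  comp1 :: "'m \<Rightarrow> 'm \<Rightarrow> 'm"  (infixr "\<cdot>\<index>" 75)
  hcomp2 :: "'c \<Rightarrow> 'c \<Rightarrow> 'c"  (infixr "\<star>\<index>" 75)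
  vcomp2 :: "'c \<Rightarrow> 'c \<Rightarrow> 'c"  (infixr "\<bullet>\<index>" 70)

locale two_category =
  fixes K :: "('o, 'm, 'c) twocat" (structure)
  assumes cat1: "category (Cell0 K) (Cell1 K) (dom1 K) (cod1 K) (id1 K) (comp1 K)"
    and vcat2: "category (Cell1 K) (Cell2 K) (src2 K) (tgt2 K) (id2 K) (vcomp2 K)"
    and hcat2: "category (Cell0 K) (Cell2 K) (\<lambda>a. dom1 K (src2 K a)) (\<lambda>a. cod1 K (src2 K a))
          (\<lambda>A. id2 K (id1 K A)) (hcomp2 K)"
    and dom1_tgt2: "a \<in> Cell2 K \<Longrightarrow> dom1 K (tgt2 K a) = dom1 K (src2 K a)"
    and cod1_tgt2: "a \<in> Cell2 K \<Longrightarrow> cod1 K (tgt2 K a) = cod1 K (src2 K a)"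
    and src2_hcomp2: "\<lbrakk>a \<in> Cell2 K; b \<in> Cell2 K; cod1 K (src2 K a) = dom1 K (src2 K b)\<rbrakk>
          \<Longrightarrow> src2 K (a \<star> b) = src2 K a \<cdot> src2 K b"
    and tgt2_hcomp2: "\<lbrakk>a \<in> Cell2 K; b \<in> Cell2 K; cod1 K (src2 K a) = dom1 K (src2 K b)\<rbrakk>
          \<Longrightarrow> tgt2 K (a \<star> b) = tgt2 K a \<cdot> tgt2 K b"
    and id2_comp1: "\<lbrakk>f \<in> Cell1 K; g \<in> Cell1 K; cod1 K f = dom1 K g\<rbrakk>
          \<Longrightarrow> id2 K (f \<cdot> g) = id2 K f \<star> id2 K g"
    and interchange2:
          "\<lbrakk>a \<in> Cell2 K; b \<in> Cell2 K; c \<in> Cell2 K; d \<in> Cell2 K;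
            cod1 K (src2 K a) = dom1 K (src2 K b); cod1 K (src2 K c) = dom1 K (src2 K d);
            tgt2 K a = src2 K c; tgt2 K b = src2 K d\<rbrakk>
          \<Longrightarrow> (a \<star> b) \<bullet> (c \<star> d) = (a \<bullet> c) \<star> (b \<bullet> d)"

record ('o, 'm, 'c, 'p, 'n, 'd) twofun =
  on0 :: "'o \<Rightarrow> 'p"
  on1 :: "'m \<Rightarrow> 'n"
  on2 :: "'c \<Rightarrow> 'd"

definition twofun_id :: "('o, 'm, 'c, 'o, 'm, 'c) twofun" where
  "twofun_id = \<lparr>on0 = id, on1 = id, on2 = id\<rparr>"

definition twofun_comp ::
    "('p, 'n, 'd, 'q, 'k, 'e) twofun \<Rightarrow> ('o, 'm, 'c, 'p, 'n, 'd) twofun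
      \<Rightarrow> ('o, 'm, 'c, 'q, 'k, 'e) twofun" where
  "twofun_comp G F = \<lparr>on0 = on0 G \<circ> on0 F, on1 = on1 G \<circ> on1 F, on2 = on2 G \<circ> on2 F\<rparr>"

locale two_functor =
  source: two_category K + target: two_category L
  for K :: "('o, 'm, 'c) twocat" and L :: "('p, 'n, 'd) twocat" +
  fixes F :: "('o, 'm, 'c, 'p, 'n, 'd) twofun"
  assumes on0_closed: "A \<in> Cell0 K \<Longrightarrow> on0 F A \<in> Cell0 L"
    and on1_closed: "f \<in> Cell1 K \<Longrightarrow> on1 F f \<in> Cell1 L"
    and on2_closed: "a \<in> Cell2 K \<Longrightarrow> on2 F a \<in> Cell2 L"
    and dom1_on1: "f \<in> Cell1 K \<Longrightarrow> dom1 L (on1 F f) = on0 F (dom1 K f)"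
    and cod1_on1: "f \<in> Cell1 K \<Longrightarrow> cod1 L (on1 F f) = on0 F (cod1 K f)"
    and src2_on2: "a \<in> Cell2 K \<Longrightarrow> src2 L (on2 F a) = on1 F (src2 K a)"
    and tgt2_on2: "a \<in> Cell2 K \<Longrightarrow> tgt2 L (on2 F a) = on1 F (tgt2 K a)"
    and on1_id1: "A \<in> Cell0 K \<Longrightarrow> on1 F (id1 K A) = id1 L (on0 F A)"
    and on2_id2: "f \<in> Cell1 K \<Longrightarrow> on2 F (id2 K f) = id2 L (on1 F f)"
    and on1_comp1: "\<lbrakk>f \<in> Cell1 K; g \<in> Cell1 K; cod1 K f = dom1 K g\<rbrakk>
          \<Longrightarrow> on1 F (f \<cdot>\<^bsub>K\<^esub> g) = on1 F f \<cdot>\<^bsub>L\<^esub> on1 F g"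
    and on2_hcomp2: "\<lbrakk>a \<in> Cell2 K; b \<in> Cell2 K; cod1 K (src2 K a) = dom1 K (src2 K b)\<rbrakk>
          \<Longrightarrow> on2 F (a \<star>\<^bsub>K\<^esub> b) = on2 F a \<star>\<^bsub>L\<^esub> on2 F b"
    and on2_vcomp2: "\<lbrakk>a \<in> Cell2 K; b \<in> Cell2 K; tgt2 K a = src2 K b\<rbrakk>
          \<Longrightarrow> on2 F (a \<bullet>\<^bsub>K\<^esub> b) = on2 F a \<bullet>\<^bsub>L\<^esub> on2 F b"

locale two_natural =
  source: two_functor K L F + target: two_functor K L G
  for K :: "('o, 'm, 'c) twocat" and L :: "('p, 'n, 'd) twocat" and F G +
  fixes \<sigma> :: "'o \<Rightarrow> 'n"
  assumes component_closed: "A \<in> Cell0 K \<Longrightarrow> \<sigma> A \<in> Cell1 L"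
    and dom1_component: "A \<in> Cell0 K \<Longrightarrow> dom1 L (\<sigma> A) = on0 F A"
    and cod1_component: "A \<in> Cell0 K \<Longrightarrow> cod1 L (\<sigma> A) = on0 G A"
    and natural1: "f \<in> Cell1 K
          \<Longrightarrow> on1 F f \<cdot>\<^bsub>L\<^esub> \<sigma> (cod1 K f) = \<sigma> (dom1 K f) \<cdot>\<^bsub>L\<^esub> on1 G f"
    and natural2: "a \<in> Cell2 K
          \<Longrightarrow> on2 F a \<star>\<^bsub>L\<^esub> id2 L (\<sigma> (cod1 K (src2 K a)))
            = id2 L (\<sigma> (dom1 K (src2 K a))) \<star>\<^bsub>L\<^esub> on2 G a"

text \<open>\<open>F\<close> is the left adjoint, with unit \<open>\<eta>\<close> and counit \<open>\<epsilon>\<close>.\<close>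

locale two_adjunction =
  left_adjoint: two_functor K L F + right_adjoint: two_functor L K G +
  unit: two_natural K K twofun_id "twofun_comp G F" \<eta> +
  counit: two_natural L L "twofun_comp F G" twofun_id \<epsilon>
  for K :: "('o, 'm, 'c) twocat" and L :: "('p, 'n, 'd) twocat" and F G \<eta> \<epsilon> +
  assumes triangle_left: "A \<in> Cell0 K \<Longrightarrow> on1 F (\<eta> A) \<cdot>\<^bsub>L\<^esub> \<epsilon> (on0 F A) = id1 L (on0 F A)"
    and triangle_right: "B \<in> Cell0 L \<Longrightarrow> \<eta> (on0 G B) \<cdot>\<^bsub>K\<^esub> on1 G (\<epsilon> B) = id1 K (on0 G B)"


section \<open>Double categories\<close>

record ('o, 'h, 'v, 's) dblcat =
  Ob :: "'o set"
  Hor :: "'h set"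
  Ver :: "'v set"
  Sq :: "'s set"
  hdom :: "'h \<Rightarrow> 'o"
  hcod :: "'h \<Rightarrow> 'o"
  vdom :: "'v \<Rightarrow> 'o"
  vcod :: "'v \<Rightarrow> 'o"
  sqtop :: "'s \<Rightarrow> 'h"
  sqbot :: "'s \<Rightarrow> 'h"
  sqleft :: "'s \<Rightarrow> 'v"
  sqright :: "'s \<Rightarrow> 'v"
  hid :: "'o \<Rightarrow> 'h"
  vid :: "'o \<Rightarrow> 'v"
  sqhid :: "'v \<Rightarrow> 's"
  sqvid :: "'h \<Rightarrow> 's"
  hcomp :: "'h \<Rightarrow> 'h \<Rightarrow> 'h"  (infixr "\<cdot>\<^sub>h\<index>" 75)
  vcomp :: "'v \<Rightarrow> 'v \<Rightarrow> 'v"  (infixr "\<cdot>\<^sub>v\<index>" 75)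
  sqhcomp :: "'s \<Rightarrow> 's \<Rightarrow> 's"  (infixr "\<star>\<^sub>h\<index>" 75)
  sqvcomp :: "'s \<Rightarrow> 's \<Rightarrow> 's"  (infixr "\<star>\<^sub>v\<index>" 70)

locale double_category =
  fixes D :: "('o, 'h, 'v, 's) dblcat" (structure)
  assumes hcat: "category (Ob D) (Hor D) (hdom D) (hcod D) (hid D) (hcomp D)"
    and vcat: "category (Ob D) (Ver D) (vdom D) (vcod D) (vid D) (vcomp D)"
    and sqhcat: "category (Ver D) (Sq D) (sqleft D) (sqright D) (sqhid D) (sqhcomp D)"
    and sqvcat: "category (Hor D) (Sq D) (sqtop D) (sqbot D) (sqvid D) (sqvcomp D)"
    and corner_tl: "a \<in> Sq D \<Longrightarrow> hdom D (sqtop D a) = vdom D (sqleft D a)"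
    and corner_tr: "a \<in> Sq D \<Longrightarrow> hcod D (sqtop D a) = vdom D (sqright D a)"
    and corner_bl: "a \<in> Sq D \<Longrightarrow> hdom D (sqbot D a) = vcod D (sqleft D a)"
    and corner_br: "a \<in> Sq D \<Longrightarrow> hcod D (sqbot D a) = vcod D (sqright D a)"
    and sqtop_sqhid: "u \<in> Ver D \<Longrightarrow> sqtop D (sqhid D u) = hid D (vdom D u)"
    and sqbot_sqhid: "u \<in> Ver D \<Longrightarrow> sqbot D (sqhid D u) = hid D (vcod D u)"
    and sqleft_sqvid: "f \<in> Hor D \<Longrightarrow> sqleft D (sqvid D f) = vid D (hdom D f)"
    and sqright_sqvid: "f \<in> Hor D \<Longrightarrow> sqright D (sqvid D f) = vid D (hcod D f)"
    and sqtop_sqhcomp: "\<lbrakk>a \<in> Sq D; b \<in> Sq D; sqright D a = sqleft D b\<rbrakk>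
          \<Longrightarrow> sqtop D (a \<star>\<^sub>h b) = sqtop D a \<cdot>\<^sub>h sqtop D b"
    and sqbot_sqhcomp: "\<lbrakk>a \<in> Sq D; b \<in> Sq D; sqright D a = sqleft D b\<rbrakk>
          \<Longrightarrow> sqbot D (a \<star>\<^sub>h b) = sqbot D a \<cdot>\<^sub>h sqbot D b"
    and sqleft_sqvcomp: "\<lbrakk>a \<in> Sq D; b \<in> Sq D; sqbot D a = sqtop D b\<rbrakk>
          \<Longrightarrow> sqleft D (a \<star>\<^sub>v b) = sqleft D a \<cdot>\<^sub>v sqleft D b"
    and sqright_sqvcomp: "\<lbrakk>a \<in> Sq D; b \<in> Sq D; sqbot D a = sqtop D b\<rbrakk>
          \<Longrightarrow> sqright D (a \<star>\<^sub>v b) = sqright D a \<cdot>\<^sub>v sqright D b"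
    and sqhid_vid: "A \<in> Ob D \<Longrightarrow> sqhid D (vid D A) = sqvid D (hid D A)"
    and sqhid_vcomp: "\<lbrakk>u \<in> Ver D; w \<in> Ver D; vcod D u = vdom D w\<rbrakk>
          \<Longrightarrow> sqhid D (u \<cdot>\<^sub>v w) = sqhid D u \<star>\<^sub>v sqhid D w"
    and sqvid_hcomp: "\<lbrakk>f \<in> Hor D; g \<in> Hor D; hcod D f = hdom D g\<rbrakk>
          \<Longrightarrow> sqvid D (f \<cdot>\<^sub>h g) = sqvid D f \<star>\<^sub>h sqvid D g"
    and interchange:
          "\<lbrakk>a \<in> Sq D; b \<in> Sq D; c \<in> Sq D; d \<in> Sq D;
            sqright D a = sqleft D b; sqright D c = sqleft D d;
            sqbot D a = sqtop D c; sqbot D b = sqtop D d\<rbrakk>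
          \<Longrightarrow> (a \<star>\<^sub>h b) \<star>\<^sub>v (c \<star>\<^sub>h d) = (a \<star>\<^sub>v c) \<star>\<^sub>h (b \<star>\<^sub>v d)"

record ('o, 'h, 'v, 's, 'p, 'k, 'w, 't) dblfun =
  onOb :: "'o \<Rightarrow> 'p"
  onHor :: "'h \<Rightarrow> 'k"
  onVer :: "'v \<Rightarrow> 'w"
  onSq :: "'s \<Rightarrow> 't"

definition dblfun_id :: "('o, 'h, 'v, 's, 'o, 'h, 'v, 's) dblfun" where
  "dblfun_id = \<lparr>onOb = id, onHor = id, onVer = id, onSq = id\<rparr>"

definition dblfun_comp ::
    "('p, 'k, 'w, 't, 'q, 'l, 'x, 'r) dblfun \<Rightarrow> ('o, 'h, 'v, 's, 'p, 'k, 'w, 't) dblfun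
      \<Rightarrow> ('o, 'h, 'v, 's, 'q, 'l, 'x, 'r) dblfun" where
  "dblfun_comp G F = \<lparr>onOb = onOb G \<circ> onOb F, onHor = onHor G \<circ> onHor F,
      onVer = onVer G \<circ> onVer F, onSq = onSq G \<circ> onSq F\<rparr>"

locale double_functor =
  source: double_category C + target: double_category D
  for C :: "('o, 'h, 'v, 's) dblcat" and D :: "('p, 'k, 'w, 't) dblcat" +
  fixes F :: "('o, 'h, 'v, 's, 'p, 'k, 'w, 't) dblfun"
  assumes onOb_closed: "A \<in> Ob C \<Longrightarrow> onOb F A \<in> Ob D"
    and onHor_closed: "f \<in> Hor C \<Longrightarrow> onHor F f \<in> Hor D"
    and onVer_closed: "u \<in> Ver C \<Longrightarrow> onVer F u \<in> Ver D"
    and onSq_closed: "a \<in> Sq C \<Longrightarrow> onSq F a \<in> Sq D"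
    and hdom_onHor: "f \<in> Hor C \<Longrightarrow> hdom D (onHor F f) = onOb F (hdom C f)"
    and hcod_onHor: "f \<in> Hor C \<Longrightarrow> hcod D (onHor F f) = onOb F (hcod C f)"
    and vdom_onVer: "u \<in> Ver C \<Longrightarrow> vdom D (onVer F u) = onOb F (vdom C u)"
    and vcod_onVer: "u \<in> Ver C \<Longrightarrow> vcod D (onVer F u) = onOb F (vcod C u)"
    and sqtop_onSq: "a \<in> Sq C \<Longrightarrow> sqtop D (onSq F a) = onHor F (sqtop C a)"
    and sqbot_onSq: "a \<in> Sq C \<Longrightarrow> sqbot D (onSq F a) = onHor F (sqbot C a)"
    and sqleft_onSq: "a \<in> Sq C \<Longrightarrow> sqleft D (onSq F a) = onVer F (sqleft C a)"
    and sqright_onSq: "a \<in> Sq C \<Longrightarrow> sqright D (onSq F a) = onVer F (sqright C a)"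
    and onHor_hid: "A \<in> Ob C \<Longrightarrow> onHor F (hid C A) = hid D (onOb F A)"
    and onVer_vid: "A \<in> Ob C \<Longrightarrow> onVer F (vid C A) = vid D (onOb F A)"
    and onSq_sqhid: "u \<in> Ver C \<Longrightarrow> onSq F (sqhid C u) = sqhid D (onVer F u)"
    and onSq_sqvid: "f \<in> Hor C \<Longrightarrow> onSq F (sqvid C f) = sqvid D (onHor F f)"
    and onHor_hcomp: "\<lbrakk>f \<in> Hor C; g \<in> Hor C; hcod C f = hdom C g\<rbrakk>
          \<Longrightarrow> onHor F (f \<cdot>\<^sub>h\<^bsub>C\<^esub> g) = onHor F f \<cdot>\<^sub>h\<^bsub>D\<^esub> onHor F g"
    and onVer_vcomp: "\<lbrakk>u \<in> Ver C; w \<in> Ver C; vcod C u = vdom C w\<rbrakk>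
          \<Longrightarrow> onVer F (u \<cdot>\<^sub>v\<^bsub>C\<^esub> w) = onVer F u \<cdot>\<^sub>v\<^bsub>D\<^esub> onVer F w"
    and onSq_sqhcomp: "\<lbrakk>a \<in> Sq C; b \<in> Sq C; sqright C a = sqleft C b\<rbrakk>
          \<Longrightarrow> onSq F (a \<star>\<^sub>h\<^bsub>C\<^esub> b) = onSq F a \<star>\<^sub>h\<^bsub>D\<^esub> onSq F b"
    and onSq_sqvcomp: "\<lbrakk>a \<in> Sq C; b \<in> Sq C; sqbot C a = sqtop C b\<rbrakk>
          \<Longrightarrow> onSq F (a \<star>\<^sub>v\<^bsub>C\<^esub> b) = onSq F a \<star>\<^sub>v\<^bsub>D\<^esub> onSq F b"

record ('o, 'h, 'v, 's) vtrans =
  compOb :: "'o \<Rightarrow> 'v"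
  compHor :: "'h \<Rightarrow> 's"

text \<open>
  Naturality with respect to a vertical morphism \<open>u\<close> is the case \<open>a = sqhid C u\<close> of
  \<open>compHor_natural\<close>, by \<open>compHor_hid\<close>.
\<close>

locale vertical_transformation =
  source: double_functor C D F + target: double_functor C D G
  for C :: "('o, 'h, 'v, 's) dblcat" and D :: "('p, 'k, 'w, 't) dblcat" and F G +
  fixes \<sigma> :: "('o, 'h, 'w, 't) vtrans"
  assumes compOb_closed: "A \<in> Ob C \<Longrightarrow> compOb \<sigma> A \<in> Ver D"
    and vdom_compOb: "A \<in> Ob C \<Longrightarrow> vdom D (compOb \<sigma> A) = onOb F A"
    and vcod_compOb: "A \<in> Ob C \<Longrightarrow> vcod D (compOb \<sigma> A) = onOb G A"
    and compHor_closed: "f \<in> Hor C \<Longrightarrow> compHor \<sigma> f \<in> Sq D"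
    and sqtop_compHor: "f \<in> Hor C \<Longrightarrow> sqtop D (compHor \<sigma> f) = onHor F f"
    and sqbot_compHor: "f \<in> Hor C \<Longrightarrow> sqbot D (compHor \<sigma> f) = onHor G f"
    and sqleft_compHor: "f \<in> Hor C \<Longrightarrow> sqleft D (compHor \<sigma> f) = compOb \<sigma> (hdom C f)"
    and sqright_compHor: "f \<in> Hor C \<Longrightarrow> sqright D (compHor \<sigma> f) = compOb \<sigma> (hcod C f)"
    and compHor_hid: "A \<in> Ob C \<Longrightarrow> compHor \<sigma> (hid C A) = sqhid D (compOb \<sigma> A)"
    and compHor_hcomp: "\<lbrakk>f \<in> Hor C; g \<in> Hor C; hcod C f = hdom C g\<rbrakk>
          \<Longrightarrow> compHor \<sigma> (f \<cdot>\<^sub>h\<^bsub>C\<^esub> g) = compHor \<sigma> f \<star>\<^sub>h\<^bsub>D\<^esub> compHor \<sigma> g"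
    and compHor_natural: "a \<in> Sq C
          \<Longrightarrow> onSq F a \<star>\<^sub>v\<^bsub>D\<^esub> compHor \<sigma> (sqbot C a) = compHor \<sigma> (sqtop C a) \<star>\<^sub>v\<^bsub>D\<^esub> onSq G a"

text \<open>
  \<open>F\<close> is the left double adjoint, with unit \<open>\<eta>\<close> and counit \<open>\<epsilon>\<close>.  Each triangle identity is an
  equation of vertical transformations, hence has an object and a horizontal-morphism part.
\<close>

locale vertical_double_adjunction =
  left_adjoint: double_functor C D F + right_adjoint: double_functor D C G +
  unit: vertical_transformation C C dblfun_id "dblfun_comp G F" \<eta> +
  counit: vertical_transformation D D "dblfun_comp F G" dblfun_id \<epsilon>
  for C :: "('o, 'h, 'v, 's) dblcat" and D :: "('p, 'k, 'w, 't) dblcat" and F G \<eta> \<epsilon> +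
  assumes triangle_left_ob: "A \<in> Ob C
          \<Longrightarrow> onVer F (compOb \<eta> A) \<cdot>\<^sub>v\<^bsub>D\<^esub> compOb \<epsilon> (onOb F A) = vid D (onOb F A)"
    and triangle_left_hor: "f \<in> Hor C
          \<Longrightarrow> onSq F (compHor \<eta> f) \<star>\<^sub>v\<^bsub>D\<^esub> compHor \<epsilon> (onHor F f) = sqvid D (onHor F f)"
    and triangle_right_ob: "B \<in> Ob D
          \<Longrightarrow> compOb \<eta> (onOb G B) \<cdot>\<^sub>v\<^bsub>C\<^esub> onVer G (compOb \<epsilon> B) = vid C (onOb G B)"
    and triangle_right_hor: "g \<in> Hor D
          \<Longrightarrow> compHor \<eta> (onHor G g) \<star>\<^sub>v\<^bsub>C\<^esub> onSq G (compHor \<epsilon> g) = sqvid C (onHor G g)"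

definition horizontal_two_category :: "('o, 'h, 'v, 's) dblcat \<Rightarrow> ('o, 'h, 's) twocat" where
  "horizontal_two_category D = \<lparr>Cell0 = Ob D, Cell1 = Hor D,
     Cell2 = {a \<in> Sq D. sqleft D a \<in> vid D ` Ob D \<and> sqright D a \<in> vid D ` Ob D},
     dom1 = hdom D, cod1 = hcod D, src2 = sqtop D, tgt2 = sqbot D,
     id1 = hid D, id2 = sqvid D,
     comp1 = hcomp D, hcomp2 = sqhcomp D, vcomp2 = sqvcomp D\<rparr>"


section \<open>Cofoldings\<close>

text \<open>A cell together with the four sides of the square that it fills.\<close>

datatype ('h, 'v, 'c) framed =
  Framed (ftop: 'h) (fbot: 'h) (fleft: 'v) (fright: 'v) (fcell: 'c)

text \<open>
  The double category of inverse quintets.  A vertical morphism \<open>A \<rightarrow> C\<close> is represented by the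
  1-cell \<open>j : C \<rightarrow> A\<close> of \<open>K\<close> of which it is the formal opposite; a square with sides
  \<open>f\<close> (top), \<open>g\<close> (bottom), \<open>j\<close> (left), \<open>k\<close> (right) is a 2-cell from \<open>j \<cdot> f\<close> to \<open>g \<cdot> k\<close>.
\<close>

definition inverse_quintets :: "('o, 'm, 'c) twocat \<Rightarrow> ('o, 'm, 'm, ('m, 'm, 'c) framed) dblcat" where
  "inverse_quintets K = \<lparr>Ob = Cell0 K, Hor = Cell1 K, Ver = Cell1 K,
     Sq = {s. ftop s \<in> Cell1 K \<and> fbot s \<in> Cell1 K \<and> fleft s \<in> Cell1 K \<and> fright s \<in> Cell1 K \<and>
              dom1 K (ftop s) = cod1 K (fleft s) \<and> cod1 K (ftop s) = cod1 K (fright s) \<and>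
              dom1 K (fbot s) = dom1 K (fleft s) \<and> cod1 K (fbot s) = dom1 K (fright s) \<and>
              fcell s \<in> Cell2 K \<and>
              src2 K (fcell s) = fleft s \<cdot>\<^bsub>K\<^esub> ftop s \<and> tgt2 K (fcell s) = fbot s \<cdot>\<^bsub>K\<^esub> fright s},
     hdom = dom1 K, hcod = cod1 K, vdom = cod1 K, vcod = dom1 K,
     sqtop = ftop, sqbot = fbot, sqleft = fleft, sqright = fright,
     hid = id1 K, vid = id1 K,
     sqhid = (\<lambda>j. Framed (id1 K (cod1 K j)) (id1 K (dom1 K j)) j j (id2 K j)),
     sqvid = (\<lambda>f. Framed f f (id1 K (dom1 K f)) (id1 K (cod1 K f)) (id2 K f)),
     hcomp = comp1 K,
     vcomp = (\<lambda>j j'. j' \<cdot>\<^bsub>K\<^esub> j),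
     sqhcomp = (\<lambda>s t. Framed (ftop s \<cdot>\<^bsub>K\<^esub> ftop t) (fbot s \<cdot>\<^bsub>K\<^esub> fbot t) (fleft s) (fright t)
        ((fcell s \<star>\<^bsub>K\<^esub> id2 K (ftop t)) \<bullet>\<^bsub>K\<^esub> (id2 K (fbot s) \<star>\<^bsub>K\<^esub> fcell t))),
     sqvcomp = (\<lambda>s t. Framed (ftop s) (fbot t) (fleft t \<cdot>\<^bsub>K\<^esub> fleft s) (fright t \<cdot>\<^bsub>K\<^esub> fright s)
        ((id2 K (fleft t) \<star>\<^bsub>K\<^esub> fcell s) \<bullet>\<^bsub>K\<^esub> (fcell t \<star>\<^bsub>K\<^esub> id2 K (fright s))))\<rparr>"

text \<open>
  A 2-cell of the horizontal 2-category is a square of the double category of inverse quintets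
  whose vertical sides are identities; \<open>onSq_eq\<close> is the identity on 2-cells under this
  identification.
\<close>

locale cofolding =
  double_functor D "inverse_quintets (horizontal_two_category D)" \<Lambda>
  for D :: "('o, 'h, 'v, 's) dblcat" and \<Lambda> +
  assumes onOb_eq: "A \<in> Ob D \<Longrightarrow> onOb \<Lambda> A = A"
    and onHor_eq: "f \<in> Hor D \<Longrightarrow> onHor \<Lambda> f = f"
    and onSq_eq: "a \<in> Cell2 (horizontal_two_category D)
          \<Longrightarrow> onSq \<Lambda> a = Framed (sqtop D a) (sqbot D a)
                (hid D (hdom D (sqtop D a))) (hid D (hcod D (sqtop D a))) a"
    and fully_faithful:
          "\<lbrakk>f \<in> Hor D; g \<in> Hor D; j \<in> Ver D; k \<in> Ver D;
            hdom D f = vdom D j; hcod D f = vdom D k;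
            hdom D g = vcod D j; hcod D g = vcod D k\<rbrakk>
          \<Longrightarrow> bij_betw (onSq \<Lambda>)
                {a \<in> Sq D. sqtop D a = f \<and> sqbot D a = g \<and> sqleft D a = j \<and> sqright D a = k}
                {s \<in> Sq (inverse_quintets (horizontal_two_category D)).
                   ftop s = f \<and> fbot s = g \<and> fleft s = onVer \<Lambda> j \<and> fright s = onVer \<Lambda> k}"


section \<open>Endomorphisms and monads\<close>

datatype ('o, 'm) endo = Endo (eob: 'o) (emor: 'm)

datatype ('o, 'm, 'c) monad = Monad (endo_of: "('o, 'm) endo") (mult: 'c) (munit: 'c)

text \<open>
  Maps record their source and target, which the underlying data do not determine.
\<close>

datatype ('e, 'm, 'c) hmap = HMap (hsrc: 'e) (htgt: 'e) (hund: 'm) (hcell: 'c)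

datatype ('e, 'v, 's) vmap = VMap (vsrc: 'e) (vtgt: 'e) (vund: 'v) (vsq: 's)

datatype ('n, 'c) mapcell = MapCell (csrc: 'n) (ctgt: 'n) (cund: 'c)

definition endos :: "('o, 'm, 'c) twocat \<Rightarrow> ('o, 'm) endo set" where
  "endos K = {e. eob e \<in> Cell0 K \<and> emor e \<in> Cell1 K \<and>
     dom1 K (emor e) = eob e \<and> cod1 K (emor e) = eob e}"

definition monads :: "('o, 'm, 'c) twocat \<Rightarrow> ('o, 'm, 'c) monad set" where
  "monads K = {m. let X = eob (endo_of m); P = emor (endo_of m); \<mu> = mult m; \<eta> = munit m in
     endo_of m \<in> endos K \<and>
     \<mu> \<in> Cell2 K \<and> src2 K \<mu> = P \<cdot>\<^bsub>K\<^esub> P \<and> tgt2 K \<mu> = P \<and>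
     \<eta> \<in> Cell2 K \<and> src2 K \<eta> = id1 K X \<and> tgt2 K \<eta> = P \<and>
     (\<mu> \<star>\<^bsub>K\<^esub> id2 K P) \<bullet>\<^bsub>K\<^esub> \<mu> = (id2 K P \<star>\<^bsub>K\<^esub> \<mu>) \<bullet>\<^bsub>K\<^esub> \<mu> \<and>
     (\<eta> \<star>\<^bsub>K\<^esub> id2 K P) \<bullet>\<^bsub>K\<^esub> \<mu> = id2 K P \<and>
     (id2 K P \<star>\<^bsub>K\<^esub> \<eta>) \<bullet>\<^bsub>K\<^esub> \<mu> = id2 K P}"

text \<open>
  Endomorphisms and monads are treated alike by means of a set \<open>E\<close> of objects and a function
  \<open>p\<close> that extracts their underlying endomorphisms: \<open>E = endos K\<close> and \<open>p = id\<close> in the first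
  case, \<open>E = monads K\<close> and \<open>p = endo_of\<close> in the second.
\<close>

definition endo_hmaps ::
    "('o, 'm, 'c) twocat \<Rightarrow> ('e \<Rightarrow> ('o, 'm) endo) \<Rightarrow> 'e set \<Rightarrow> ('e, 'm, 'c) hmap set" where
  "endo_hmaps K p E = {h. hsrc h \<in> E \<and> htgt h \<in> E \<and>
     hund h \<in> Cell1 K \<and> dom1 K (hund h) = eob (p (hsrc h)) \<and> cod1 K (hund h) = eob (p (htgt h)) \<and>
     hcell h \<in> Cell2 K \<and> src2 K (hcell h) = hund h \<cdot>\<^bsub>K\<^esub> emor (p (htgt h)) \<and>
     tgt2 K (hcell h) = emor (p (hsrc h)) \<cdot>\<^bsub>K\<^esub> hund h}"

definition monad_hmaps ::
    "('o, 'm, 'c) twocat \<Rightarrow> (('o, 'm, 'c) monad, 'm, 'c) hmap set" where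
  "monad_hmaps K = {h \<in> endo_hmaps K endo_of (monads K).
     let F = hund h; \<phi> = hcell h; S = hsrc h; T = htgt h;
         P = emor (endo_of S); Q = emor (endo_of T) in
     (id2 K F \<star>\<^bsub>K\<^esub> munit T) \<bullet>\<^bsub>K\<^esub> \<phi> = munit S \<star>\<^bsub>K\<^esub> id2 K F \<and>
     (id2 K F \<star>\<^bsub>K\<^esub> mult T) \<bullet>\<^bsub>K\<^esub> \<phi>
       = (\<phi> \<star>\<^bsub>K\<^esub> id2 K Q) \<bullet>\<^bsub>K\<^esub> (id2 K P \<star>\<^bsub>K\<^esub> \<phi>) \<bullet>\<^bsub>K\<^esub> (mult S \<star>\<^bsub>K\<^esub> id2 K F)}"

definition hmap_id ::
    "('o, 'm, 'c) twocat \<Rightarrow> ('e \<Rightarrow> ('o, 'm) endo) \<Rightarrow> 'e \<Rightarrow> ('e, 'm, 'c) hmap" where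
  "hmap_id K p e = HMap e e (id1 K (eob (p e))) (id2 K (emor (p e)))"

definition hmap_comp ::
    "('o, 'm, 'c) twocat \<Rightarrow> ('e, 'm, 'c) hmap \<Rightarrow> ('e, 'm, 'c) hmap \<Rightarrow> ('e, 'm, 'c) hmap" where
  "hmap_comp K h h' = HMap (hsrc h) (htgt h') (hund h \<cdot>\<^bsub>K\<^esub> hund h')
     ((id2 K (hund h) \<star>\<^bsub>K\<^esub> hcell h') \<bullet>\<^bsub>K\<^esub> (hcell h \<star>\<^bsub>K\<^esub> id2 K (hund h')))"

definition endo_cells ::
    "('o, 'm, 'c) twocat \<Rightarrow> ('e \<Rightarrow> ('o, 'm) endo) \<Rightarrow> ('e, 'm, 'c) hmap set
      \<Rightarrow> (('e, 'm, 'c) hmap, 'c) mapcell set" where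
  "endo_cells K p M = {a. csrc a \<in> M \<and> ctgt a \<in> M \<and>
     hsrc (csrc a) = hsrc (ctgt a) \<and> htgt (csrc a) = htgt (ctgt a) \<and>
     cund a \<in> Cell2 K \<and> src2 K (cund a) = hund (csrc a) \<and> tgt2 K (cund a) = hund (ctgt a) \<and>
     hcell (csrc a) \<bullet>\<^bsub>K\<^esub> (id2 K (emor (p (hsrc (csrc a)))) \<star>\<^bsub>K\<^esub> cund a)
       = (cund a \<star>\<^bsub>K\<^esub> id2 K (emor (p (htgt (csrc a))))) \<bullet>\<^bsub>K\<^esub> hcell (ctgt a)}"

definition endo_two_category_on ::
    "('o, 'm, 'c) twocat \<Rightarrow> ('e \<Rightarrow> ('o, 'm) endo) \<Rightarrow> 'e set \<Rightarrow> ('e, 'm, 'c) hmap set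
      \<Rightarrow> ('e, ('e, 'm, 'c) hmap, (('e, 'm, 'c) hmap, 'c) mapcell) twocat" where
  "endo_two_category_on K p E M = \<lparr>Cell0 = E, Cell1 = M, Cell2 = endo_cells K p M,
     dom1 = hsrc, cod1 = htgt, src2 = csrc, tgt2 = ctgt,
     id1 = hmap_id K p, id2 = (\<lambda>h. MapCell h h (id2 K (hund h))),
     comp1 = hmap_comp K,
     hcomp2 = (\<lambda>a b. MapCell (hmap_comp K (csrc a) (csrc b)) (hmap_comp K (ctgt a) (ctgt b))
        (cund a \<star>\<^bsub>K\<^esub> cund b)),
     vcomp2 = (\<lambda>a b. MapCell (csrc a) (ctgt b) (cund a \<bullet>\<^bsub>K\<^esub> cund b))\<rparr>"

definition End2 where
  "End2 K = endo_two_category_on K id (endos K) (endo_hmaps K id (endos K))"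

definition Mnd2 where
  "Mnd2 K = endo_two_category_on K endo_of (monads K) (monad_hmaps K)"

text \<open>On each component the forgetful functors only replace monads by their endomorphisms.\<close>

definition forget2 where
  "forget2 = \<lparr>on0 = endo_of, on1 = map_hmap endo_of id id,
     on2 = map_mapcell (map_hmap endo_of id id) id\<rparr>"

definition two_category_admits_free_monads :: "('o, 'm, 'c) twocat \<Rightarrow> bool" where
  "two_category_admits_free_monads K \<longleftrightarrow>
     (\<exists>R \<eta> \<epsilon>. two_adjunction (Mnd2 K) (End2 K) forget2 R \<eta> \<epsilon> \<and>
        (\<forall>e \<in> endos K. hund (\<epsilon> e) = id1 K (eob e)))"

definition endo_vmaps ::
    "('o, 'h, 'v, 's) dblcat \<Rightarrow> ('e \<Rightarrow> ('o, 'h) endo) \<Rightarrow> 'e set \<Rightarrow> ('e, 'v, 's) vmap set" where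
  "endo_vmaps D p E = {w. vsrc w \<in> E \<and> vtgt w \<in> E \<and>
     vund w \<in> Ver D \<and> vdom D (vund w) = eob (p (vsrc w)) \<and> vcod D (vund w) = eob (p (vtgt w)) \<and>
     vsq w \<in> Sq D \<and> sqtop D (vsq w) = emor (p (vsrc w)) \<and> sqbot D (vsq w) = emor (p (vtgt w)) \<and>
     sqleft D (vsq w) = vund w \<and> sqright D (vsq w) = vund w}"

definition monad_vmaps ::
    "('o, 'h, 'v, 's) dblcat \<Rightarrow> (('o, 'h, 's) monad, 'v, 's) vmap set" where
  "monad_vmaps D = {w \<in> endo_vmaps D endo_of (monads (horizontal_two_category D)).
     munit (vsrc w) \<star>\<^sub>v\<^bsub>D\<^esub> vsq w = sqhid D (vund w) \<star>\<^sub>v\<^bsub>D\<^esub> munit (vtgt w) \<and>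
     mult (vsrc w) \<star>\<^sub>v\<^bsub>D\<^esub> vsq w = (vsq w \<star>\<^sub>h\<^bsub>D\<^esub> vsq w) \<star>\<^sub>v\<^bsub>D\<^esub> mult (vtgt w)}"

definition endo_squares ::
    "('o, 'h, 'v, 's) dblcat \<Rightarrow> ('e, 'h, 's) hmap set \<Rightarrow> ('e, 'v, 's) vmap set
      \<Rightarrow> (('e, 'h, 's) hmap, ('e, 'v, 's) vmap, 's) framed set" where
  "endo_squares D H V = {a. ftop a \<in> H \<and> fbot a \<in> H \<and> fleft a \<in> V \<and> fright a \<in> V \<and>
     hsrc (ftop a) = vsrc (fleft a) \<and> htgt (ftop a) = vsrc (fright a) \<and>
     hsrc (fbot a) = vtgt (fleft a) \<and> htgt (fbot a) = vtgt (fright a) \<and>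
     fcell a \<in> Sq D \<and>
     sqtop D (fcell a) = hund (ftop a) \<and> sqbot D (fcell a) = hund (fbot a) \<and>
     sqleft D (fcell a) = vund (fleft a) \<and> sqright D (fcell a) = vund (fright a) \<and>
     hcell (ftop a) \<star>\<^sub>v\<^bsub>D\<^esub> (vsq (fleft a) \<star>\<^sub>h\<^bsub>D\<^esub> fcell a)
       = (fcell a \<star>\<^sub>h\<^bsub>D\<^esub> vsq (fright a)) \<star>\<^sub>v\<^bsub>D\<^esub> hcell (fbot a)}"

definition endo_double_category_on ::
    "('o, 'h, 'v, 's) dblcat \<Rightarrow> ('e \<Rightarrow> ('o, 'h) endo)
      \<Rightarrow> 'e set \<Rightarrow> ('e, 'h, 's) hmap set \<Rightarrow> ('e, 'v, 's) vmap set
      \<Rightarrow> ('e, ('e, 'h, 's) hmap, ('e, 'v, 's) vmap,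
          (('e, 'h, 's) hmap, ('e, 'v, 's) vmap, 's) framed) dblcat" where
  "endo_double_category_on D p E H V =
    (let hcmp = hmap_comp (horizontal_two_category D);
         vcmp = (\<lambda>w w'. VMap (vsrc w) (vtgt w') (vund w \<cdot>\<^sub>v\<^bsub>D\<^esub> vund w') (vsq w \<star>\<^sub>v\<^bsub>D\<^esub> vsq w'));
         hide = hmap_id (horizontal_two_category D) p;
         vide = (\<lambda>e. VMap e e (vid D (eob (p e))) (sqvid D (emor (p e)))) in
     \<lparr>Ob = E, Hor = H, Ver = V, Sq = endo_squares D H V,
      hdom = hsrc, hcod = htgt, vdom = vsrc, vcod = vtgt,
      sqtop = ftop, sqbot = fbot, sqleft = fleft, sqright = fright,
      hid = hide, vid = vide,
      sqhid = (\<lambda>w. Framed (hide (vsrc w)) (hide (vtgt w)) w w (sqhid D (vund w))),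
      sqvid = (\<lambda>h. Framed h h (vide (hsrc h)) (vide (htgt h)) (sqvid D (hund h))),
      hcomp = hcmp, vcomp = vcmp,
      sqhcomp = (\<lambda>a b. Framed (hcmp (ftop a) (ftop b)) (hcmp (fbot a) (fbot b))
         (fleft a) (fright b) (fcell a \<star>\<^sub>h\<^bsub>D\<^esub> fcell b)),
      sqvcomp = (\<lambda>a b. Framed (ftop a) (fbot b)
         (vcmp (fleft a) (fleft b)) (vcmp (fright a) (fright b)) (fcell a \<star>\<^sub>v\<^bsub>D\<^esub> fcell b))\<rparr>)"

definition EndD where
  "EndD D = (let K = horizontal_two_category D in
     endo_double_category_on D id (endos K) (endo_hmaps K id (endos K)) (endo_vmaps D id (endos K)))"

definition MndD where
  "MndD D = (let K = horizontal_two_category D in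
     endo_double_category_on D endo_of (monads K) (monad_hmaps K) (monad_vmaps D))"

definition forgetD where
  "forgetD = \<lparr>onOb = endo_of, onHor = map_hmap endo_of id id, onVer = map_vmap endo_of id id,
     onSq = map_framed (map_hmap endo_of id id) (map_vmap endo_of id id) id\<rparr>"

definition double_category_admits_free_monads :: "('o, 'h, 'v, 's) dblcat \<Rightarrow> bool" where
  "double_category_admits_free_monads D \<longleftrightarrow>
     (\<exists>R \<eta> \<epsilon>. vertical_double_adjunction (EndD D) (MndD D) R forgetD \<eta> \<epsilon> \<and>
        (\<forall>e \<in> Ob (EndD D). vund (compOb \<eta> e) = vid D (eob e)))"

end

theory Submission
  imports Defs
begin

text \<open>
  A cofolding turns a vertical endomorphism map \<open>(u, a) : A \<rightarrow> B\<close> into a horizontal endomorphism map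
  \<open>(u\<^sup>*, \<Lambda> a) : B \<rightarrow> A\<close>.  Since \<open>\<Lambda>\<close> is functorial and faithful, the equations of a vertical monad
  map become those of a horizontal monad map, and the equation of an endomorphism square becomes
  that of a 2-cell between composites of horizontal maps.  A counit component of the right
  2-adjoint is carried by an identity, so it is also a vertical map in the opposite direction, and
  its universal property among horizontal maps into \<open>A\<close> translates into a universal property
  among vertical maps out of \<open>A\<close>; as the 2-adjunction also transposes 2-cells, this extends to
  squares.  Universal arrows for vertical morphisms and for squares that are compatible with
  horizontal composition assemble to a vertical left double adjoint.
\<close>

section \<open>Universal arrows\<close>

text \<open>Full faithfulness of \<Lambda> concerns squares with prescribed vertical sides; the
  passage from \<open>u\<close> to \<open>onVer \<Lambda> u\<close> is assumed neither injective nor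
  surjective. A horizontal map thus comes from a vertical one only if its underlying morphism is
  known to be some \<open>onVer \<Lambda> u\<close>, and then relative to the chosen
  \<open>u\<close>. Here the normalization of the counit is decisive: it forces the 2-adjunction to
  be the identity on underlying 1-cells and 2-cells, so a transpose is carried by the same
  \<open>onVer \<Lambda> u\<close> and unfolds over the same \<open>u\<close>. As cofolding reverses
  vertical morphisms, a right adjoint for horizontal maps becomes a left adjoint for vertical ones;
  on horizontal morphisms nothing is reversed, and the double adjoint is the given 2-functor.
  Vertical morphisms and squares each form a category under vertical composition, so one account of
  universal arrows serves both; the sides of squares and their horizontal composites are then
  compared by uniqueness.\<close>

locale universal_arrows =
  C: category ObC MorC domC codC ideC compC + D: category ObD MorD domD codD ideD compD
  for ObC :: "'a set" and MorC :: "'m set" and domC codC ideC compC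
    and ObD :: "'b set" and MorD :: "'n set" and domD codD ideD compD +
  fixes G0 :: "'b \<Rightarrow> 'a" and G1 :: "'n \<Rightarrow> 'm" and R0 :: "'a \<Rightarrow> 'b" and \<eta> :: "'a \<Rightarrow> 'm"
  assumes G0_closed: "B \<in> ObD \<Longrightarrow> G0 B \<in> ObC"
    and G1_closed: "t \<in> MorD \<Longrightarrow> G1 t \<in> MorC"
    and dom_G1: "t \<in> MorD \<Longrightarrow> domC (G1 t) = G0 (domD t)"
    and cod_G1: "t \<in> MorD \<Longrightarrow> codC (G1 t) = G0 (codD t)"
    and G1_ide: "B \<in> ObD \<Longrightarrow> G1 (ideD B) = ideC (G0 B)"
    and G1_comp: "\<lbrakk>s \<in> MorD; t \<in> MorD; codD s = domD t\<rbrakk> \<Longrightarrow> G1 (compD s t) = compC (G1 s) (G1 t)"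
    and R0_closed: "A \<in> ObC \<Longrightarrow> R0 A \<in> ObD"
    and eta_closed: "A \<in> ObC \<Longrightarrow> \<eta> A \<in> MorC"
    and dom_eta: "A \<in> ObC \<Longrightarrow> domC (\<eta> A) = A"
    and cod_eta: "A \<in> ObC \<Longrightarrow> codC (\<eta> A) = G0 (R0 A)"
    and universal: "\<lbrakk>u \<in> MorC; B \<in> ObD; codC u = G0 B\<rbrakk>
          \<Longrightarrow> \<exists>!t. t \<in> MorD \<and> domD t = R0 (domC u) \<and> codD t = B \<and> compC (\<eta> (domC u)) (G1 t) = u"
begin

definition lift :: "'b \<Rightarrow> 'm \<Rightarrow> 'n" where
  "lift B u = (THE t. t \<in> MorD \<and> domD t = R0 (domC u) \<and> codD t = B \<and>
     compC (\<eta> (domC u)) (G1 t) = u)"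

definition R1 :: "'m \<Rightarrow> 'n" where
  "R1 u = lift (R0 (codC u)) (compC u (\<eta> (codC u)))"

definition counit :: "'b \<Rightarrow> 'n" where
  "counit B = lift B (ideC (G0 B))"

lemma
  assumes "u \<in> MorC" "B \<in> ObD" "codC u = G0 B"
  shows lift_closed: "lift B u \<in> MorD"
    and dom_lift: "domD (lift B u) = R0 (domC u)"
    and cod_lift: "codD (lift B u) = B"
    and eta_lift: "compC (\<eta> (domC u)) (G1 (lift B u)) = u"
  using theI'[OF universal[OF assms]] unfolding lift_def by auto

lemmas C_simps = C.dom_closed C.cod_closed C.ide_closed C.dom_ide C.cod_ide
  C.comp_closed C.dom_comp C.cod_comp C.ide_comp C.comp_ide

lemmas D_simps = D.dom_closed D.cod_closed D.ide_closed D.dom_ide D.cod_ide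
  D.comp_closed D.dom_comp D.cod_comp D.ide_comp D.comp_ide

lemmas G_simps = G0_closed G1_closed dom_G1 cod_G1 G1_ide G1_comp

lemmas eta_simps = R0_closed eta_closed dom_eta cod_eta

lemma lift_unique:
  assumes "t \<in> MorD" "domD t = R0 A" "A \<in> ObC" "compC (\<eta> A) (G1 t) = u"
  shows "t = lift (codD t) u"
proof -
  have u: "u \<in> MorC" "domC u = A" "codC u = G0 (codD t)"
    using assms(4)[symmetric] assms(1-3) by (simp_all add: C_simps G_simps eta_simps)
  show ?thesis
    unfolding lift_def using the1_equality[OF universal[OF u(1) _ u(3)], of t] assms u
    by (simp add: D_simps)
qed

text \<open>Both arrows are lifts of the same morphism. This cancellation yields functoriality,
  naturality of the counit and the left triangle identity.\<close>

lemma eq_by_eta: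
  assumes "s \<in> MorD" "t \<in> MorD" "domD s = R0 A" "domD t = R0 A" "A \<in> ObC" "codD s = codD t"
    and "compC (\<eta> A) (G1 s) = compC (\<eta> A) (G1 t)"
  shows "s = t"
  using lift_unique[OF assms(1,3,5,7)] lift_unique[OF assms(2,4,5) refl] assms(6) by simp

lemma
  assumes "u \<in> MorC"
  shows R1_closed: "R1 u \<in> MorD" and dom_R1: "domD (R1 u) = R0 (domC u)"
    and cod_R1: "codD (R1 u) = R0 (codC u)"
    and eta_natural: "compC u (\<eta> (codC u)) = compC (\<eta> (domC u)) (G1 (R1 u))"
  using assms eta_lift[of "compC u (\<eta> (codC u))" "R0 (codC u)"] unfolding R1_def
  by (simp_all add: C_simps eta_simps lift_closed dom_lift cod_lift)

lemmas R_simps = R1_closed dom_R1 cod_R1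

lemma
  assumes "B \<in> ObD"
  shows counit_closed: "counit B \<in> MorD" and dom_counit: "domD (counit B) = R0 (G0 B)"
    and cod_counit: "codD (counit B) = B"
    and triangle_right: "compC (\<eta> (G0 B)) (G1 (counit B)) = ideC (G0 B)"
  using assms eta_lift[of "ideC (G0 B)" B] unfolding counit_def
  by (simp_all add: C_simps G_simps lift_closed dom_lift cod_lift)

lemmas counit_simps = counit_closed dom_counit cod_counit

text \<open>The left adjoint is recognized by its naturality equation; in double categories this
  identifies the sides and the horizontal composites of adjoint squares.\<close>

lemma R1_unique:
  assumes "u \<in> MorC" "t \<in> MorD" "domD t = R0 (domC u)" "codD t = R0 (codC u)"
    and "compC (\<eta> (domC u)) (G1 t) = compC u (\<eta> (codC u))"
  shows "R1 u = t"
  by (rule eq_by_eta[where A = "domC u"])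
    (use assms in \<open>simp_all add: C_simps R_simps eta_natural\<close>)

lemma counit_unique:
  assumes "B \<in> ObD" "t \<in> MorD" "domD t = R0 (G0 B)" "codD t = B"
    and "compC (\<eta> (G0 B)) (G1 t) = ideC (G0 B)"
  shows "counit B = t"
  by (rule eq_by_eta[where A = "G0 B"])
    (use assms in \<open>simp_all add: G_simps counit_simps triangle_right\<close>)

lemma R1_ide: "A \<in> ObC \<Longrightarrow> R1 (ideC A) = ideD (R0 A)"
  by (rule R1_unique) (use C.ide_comp[of "\<eta> A"] C.comp_ide[of "\<eta> A"] in
    \<open>simp_all add: C_simps D_simps G_simps eta_simps\<close>)

lemma R1_comp:
  assumes "u \<in> MorC" "v \<in> MorC" "codC u = domC v"
  shows "R1 (compC u v) = compD (R1 u) (R1 v)"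
proof (rule R1_unique)
  have "compC (\<eta> (domC u)) (compC (G1 (R1 u)) (G1 (R1 v)))
      = compC (compC u (\<eta> (codC u))) (G1 (R1 v))"
    using assms eta_natural[of u]
    by (simp add: C.comp_assoc[symmetric] C_simps G_simps R_simps eta_simps)
  also have "\<dots> = compC u (compC v (\<eta> (codC v)))"
    using assms by (simp add: C.comp_assoc C_simps G_simps R_simps eta_simps eta_natural)
  finally show "compC (\<eta> (domC (compC u v))) (G1 (compD (R1 u) (R1 v)))
      = compC (compC u v) (\<eta> (codC (compC u v)))"
    using assms by (simp add: C.comp_assoc C_simps G_simps R_simps eta_simps)
qed (use assms in \<open>simp_all add: C_simps D_simps R_simps\<close>)

text \<open>Applying \<open>G1\<close> and composing with the unit reduces both sides to
  \<open>G1 t\<close>.\<close>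

lemma counit_natural:
  assumes "t \<in> MorD"
  shows "compD (R1 (G1 t)) (counit (codD t)) = compD (counit (domD t)) t"
proof (rule eq_by_eta[where A = "G0 (domD t)"])
  have "compC (\<eta> (G0 (domD t))) (compC (G1 (R1 (G1 t))) (G1 (counit (codD t))))
      = compC (compC (G1 t) (\<eta> (G0 (codD t)))) (G1 (counit (codD t)))"
    using assms eta_natural[of "G1 t"]
    by (simp add: C.comp_assoc[symmetric] C_simps D_simps G_simps R_simps eta_simps counit_simps)
  also have "\<dots> = G1 t"
    using assms C.comp_ide[of "G1 t"]
    by (simp add: C.comp_assoc C_simps D_simps G_simps R_simps eta_simps counit_simps triangle_right)
  also have "\<dots> = compC (\<eta> (G0 (domD t))) (compC (G1 (counit (domD t))) (G1 t))"
    using assms C.ide_comp[of "G1 t"]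
    by (simp add: C.comp_assoc[symmetric] C_simps D_simps G_simps R_simps eta_simps counit_simps
        triangle_right)
  finally show "compC (\<eta> (G0 (domD t))) (G1 (compD (R1 (G1 t)) (counit (codD t))))
      = compC (\<eta> (G0 (domD t))) (G1 (compD (counit (domD t)) t))"
    using assms by (simp add: C_simps D_simps G_simps R_simps eta_simps counit_simps)
qed (use assms in \<open>simp_all add: C_simps D_simps G_simps R_simps eta_simps counit_simps\<close>)

text \<open>Naturality of the unit at the unit itself produces a composite to which the other
  triangle identity applies.\<close>

lemma triangle_left:
  assumes "A \<in> ObC"
  shows "compD (R1 (\<eta> A)) (counit (R0 A)) = ideD (R0 A)"
proof (rule eq_by_eta[where A = A])
  have "compC (\<eta> A) (compC (G1 (R1 (\<eta> A))) (G1 (counit (R0 A))))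
      = compC (compC (\<eta> A) (\<eta> (G0 (R0 A)))) (G1 (counit (R0 A)))"
    using assms eta_natural[of "\<eta> A"]
    by (simp add: C.comp_assoc[symmetric] C_simps D_simps G_simps R_simps eta_simps counit_simps)
  also have "\<dots> = compC (\<eta> A) (ideC (G0 (R0 A)))"
    using assms
    by (simp add: C.comp_assoc C_simps D_simps G_simps R_simps eta_simps counit_simps triangle_right)
  finally show "compC (\<eta> A) (G1 (compD (R1 (\<eta> A)) (counit (R0 A))))
      = compC (\<eta> A) (G1 (ideD (R0 A)))"
    using assms by (simp add: C_simps D_simps G_simps R_simps eta_simps counit_simps)
qed (use assms in \<open>simp_all add: C_simps D_simps G_simps R_simps eta_simps counit_simps\<close>)

end

section \<open>Calculation rules for double categories\<close>

context double_category
begin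

sublocale hor: category "Ob D" "Hor D" "hdom D" "hcod D" "hid D" "hcomp D"
  by (rule hcat)

sublocale ver: category "Ob D" "Ver D" "vdom D" "vcod D" "vid D" "vcomp D"
  by (rule vcat)

sublocale sqh: category "Ver D" "Sq D" "sqleft D" "sqright D" "sqhid D" "sqhcomp D"
  by (rule sqhcat)

sublocale sqv: category "Hor D" "Sq D" "sqtop D" "sqbot D" "sqvid D" "sqvcomp D"
  by (rule sqvcat)

lemmas closure_simps =
  hor.dom_closed hor.cod_closed hor.ide_closed hor.dom_ide hor.cod_ide
  hor.comp_closed hor.dom_comp hor.cod_comp
  ver.dom_closed ver.cod_closed ver.ide_closed ver.dom_ide ver.cod_ide
  ver.comp_closed ver.dom_comp ver.cod_comp
  sqh.dom_closed sqh.cod_closed sqh.ide_closed sqh.dom_ide sqh.cod_ide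
  sqh.comp_closed sqh.dom_comp sqh.cod_comp
  sqv.dom_closed sqv.cod_closed sqv.ide_closed sqv.dom_ide sqv.cod_ide
  sqv.comp_closed sqv.dom_comp sqv.cod_comp
  sqtop_sqhid sqbot_sqhid sqleft_sqvid sqright_sqvid
  sqtop_sqhcomp sqbot_sqhcomp sqleft_sqvcomp sqright_sqvcomp

lemma unit_simps:
  "\<lbrakk>f \<in> Hor D; hdom D f = A\<rbrakk> \<Longrightarrow> hid D A \<cdot>\<^sub>h f = f"
  "\<lbrakk>f \<in> Hor D; hcod D f = A\<rbrakk> \<Longrightarrow> f \<cdot>\<^sub>h hid D A = f"
  "\<lbrakk>u \<in> Ver D; vdom D u = A\<rbrakk> \<Longrightarrow> vid D A \<cdot>\<^sub>v u = u"
  "\<lbrakk>u \<in> Ver D; vcod D u = A\<rbrakk> \<Longrightarrow> u \<cdot>\<^sub>v vid D A = u"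
  "\<lbrakk>a \<in> Sq D; sqleft D a = u\<rbrakk> \<Longrightarrow> sqhid D u \<star>\<^sub>h a = a"
  "\<lbrakk>a \<in> Sq D; sqright D a = u\<rbrakk> \<Longrightarrow> a \<star>\<^sub>h sqhid D u = a"
  "\<lbrakk>a \<in> Sq D; sqtop D a = f\<rbrakk> \<Longrightarrow> sqvid D f \<star>\<^sub>v a = a"
  "\<lbrakk>a \<in> Sq D; sqbot D a = f\<rbrakk> \<Longrightarrow> a \<star>\<^sub>v sqvid D f = a"
  using hor.ide_comp hor.comp_ide ver.ide_comp ver.comp_ide sqh.ide_comp sqh.comp_ide
    sqv.ide_comp sqv.comp_ide by auto

text \<open>The two identity squares on an object coincide, so whiskering with the vertical one is
  trivial as well.\<close>

lemma sqvid_hid_unit: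
  assumes "a \<in> Sq D" "A \<in> Ob D"
  shows "sqleft D a = vid D A \<Longrightarrow> sqvid D (hid D A) \<star>\<^sub>h a = a"
    and "sqright D a = vid D A \<Longrightarrow> a \<star>\<^sub>h sqvid D (hid D A) = a"
  using assms by (simp_all add: sqhid_vid[symmetric] unit_simps)

text \<open>Oriented so that rewriting normalizes every corner of a square to an end of its top or
  bottom.\<close>

lemma corner_simps:
  "a \<in> Sq D \<Longrightarrow> vdom D (sqleft D a) = hdom D (sqtop D a)"
  "a \<in> Sq D \<Longrightarrow> vdom D (sqright D a) = hcod D (sqtop D a)"
  "a \<in> Sq D \<Longrightarrow> vcod D (sqleft D a) = hdom D (sqbot D a)"
  "a \<in> Sq D \<Longrightarrow> vcod D (sqright D a) = hcod D (sqbot D a)"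
  by (simp_all add: corner_tl corner_tr corner_bl corner_br)

abbreviation HD where
  "HD \<equiv> horizontal_two_category D"

lemma HD_simps [simp]:
  "Cell0 HD = Ob D" "Cell1 HD = Hor D" "dom1 HD = hdom D" "cod1 HD = hcod D"
  "src2 HD = sqtop D" "tgt2 HD = sqbot D" "id1 HD = hid D" "id2 HD = sqvid D"
  "comp1 HD = hcomp D" "hcomp2 HD = sqhcomp D" "vcomp2 HD = sqvcomp D"
  by (simp_all add: horizontal_two_category_def)

text \<open>The corners determine which vertical identities occur, so the existential condition in
  the definition turns into two equations fit for rewriting.\<close>

lemma Cell2_HD:
  "a \<in> Cell2 HD \<longleftrightarrow> a \<in> Sq D \<and> sqleft D a = vid D (hdom D (sqtop D a))
     \<and> sqright D a = vid D (hcod D (sqtop D a))"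
proof
  assume a: "a \<in> Cell2 HD"
  then obtain A B where "a \<in> Sq D" "A \<in> Ob D" "B \<in> Ob D" "sqleft D a = vid D A"
    "sqright D a = vid D B"
    by (auto simp: horizontal_two_category_def)
  then show "a \<in> Sq D \<and> sqleft D a = vid D (hdom D (sqtop D a))
      \<and> sqright D a = vid D (hcod D (sqtop D a))"
    by (simp add: corner_simps[symmetric] closure_simps)
qed (auto simp: horizontal_two_category_def closure_simps)

end

section \<open>Left double adjoints from universal arrows\<close>

lemma dblfun_id_functor: "double_category X \<Longrightarrow> double_functor X X dblfun_id"
  by (simp add: double_functor_def double_functor_axioms_def dblfun_id_def)

lemma dblfun_comp_functor:
  assumes "double_functor X Y F" "double_functor Y Z H"
  shows "double_functor X Z (dblfun_comp H F)"
proof -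
  interpret F: double_functor X Y F by fact
  interpret H: double_functor Y Z H by fact
  note [simp] = F.source.closure_simps
    F.onOb_closed F.onHor_closed F.onVer_closed F.onSq_closed
    F.hdom_onHor F.hcod_onHor F.vdom_onVer F.vcod_onVer F.sqtop_onSq F.sqbot_onSq
    F.sqleft_onSq F.sqright_onSq F.onHor_hid F.onVer_vid F.onSq_sqhid F.onSq_sqvid
    F.onHor_hcomp F.onVer_vcomp F.onSq_sqhcomp F.onSq_sqvcomp
    H.onOb_closed H.onHor_closed H.onVer_closed H.onSq_closed
    H.hdom_onHor H.hcod_onHor H.vdom_onVer H.vcod_onVer H.sqtop_onSq H.sqbot_onSq
    H.sqleft_onSq H.sqright_onSq H.onHor_hid H.onVer_vid H.onSq_sqhid H.onSq_sqvid
    H.onHor_hcomp H.onVer_vcomp H.onSq_sqhcomp H.onSq_sqvcomp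
  show ?thesis
    by (intro double_functor.intro double_functor_axioms.intro F.source.double_category_axioms
        H.target.double_category_axioms) (simp_all add: dblfun_comp_def)
qed

text \<open>The horizontal part of the left adjoint is given in advance. \<open>universal_sq\<close>
  fixes only the top and bottom of the factorizing square; its left and right sides are forced by
  uniqueness in \<open>universal_ver\<close>.\<close>

locale double_universal_arrows =
  G: double_functor D C G
  for D :: "('p, 'k, 'w, 't) dblcat" and C :: "('o, 'h, 'v, 's) dblcat" and G +
  fixes Rob :: "'o \<Rightarrow> 'p" and Rhor :: "'h \<Rightarrow> 'k" and \<eta> :: "('o, 'h, 'v, 's) vtrans"
  assumes Rob_closed: "A \<in> Ob C \<Longrightarrow> Rob A \<in> Ob D"
    and Rhor_closed: "f \<in> Hor C \<Longrightarrow> Rhor f \<in> Hor D"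
    and hdom_Rhor: "f \<in> Hor C \<Longrightarrow> hdom D (Rhor f) = Rob (hdom C f)"
    and hcod_Rhor: "f \<in> Hor C \<Longrightarrow> hcod D (Rhor f) = Rob (hcod C f)"
    and Rhor_hid: "A \<in> Ob C \<Longrightarrow> Rhor (hid C A) = hid D (Rob A)"
    and Rhor_hcomp: "\<lbrakk>f \<in> Hor C; g \<in> Hor C; hcod C f = hdom C g\<rbrakk>
          \<Longrightarrow> Rhor (f \<cdot>\<^sub>h\<^bsub>C\<^esub> g) = Rhor f \<cdot>\<^sub>h\<^bsub>D\<^esub> Rhor g"
    and eta_ob: "A \<in> Ob C \<Longrightarrow> compOb \<eta> A \<in> Ver C"
    and vdom_eta: "A \<in> Ob C \<Longrightarrow> vdom C (compOb \<eta> A) = A"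
    and vcod_eta: "A \<in> Ob C \<Longrightarrow> vcod C (compOb \<eta> A) = onOb G (Rob A)"
    and eta_hor: "f \<in> Hor C \<Longrightarrow> compHor \<eta> f \<in> Sq C"
    and sqtop_eta: "f \<in> Hor C \<Longrightarrow> sqtop C (compHor \<eta> f) = f"
    and sqbot_eta: "f \<in> Hor C \<Longrightarrow> sqbot C (compHor \<eta> f) = onHor G (Rhor f)"
    and sqleft_eta: "f \<in> Hor C \<Longrightarrow> sqleft C (compHor \<eta> f) = compOb \<eta> (hdom C f)"
    and sqright_eta: "f \<in> Hor C \<Longrightarrow> sqright C (compHor \<eta> f) = compOb \<eta> (hcod C f)"
    and eta_hid: "A \<in> Ob C \<Longrightarrow> compHor \<eta> (hid C A) = sqhid C (compOb \<eta> A)"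
    and eta_hcomp: "\<lbrakk>f \<in> Hor C; g \<in> Hor C; hcod C f = hdom C g\<rbrakk>
          \<Longrightarrow> compHor \<eta> (f \<cdot>\<^sub>h\<^bsub>C\<^esub> g) = compHor \<eta> f \<star>\<^sub>h\<^bsub>C\<^esub> compHor \<eta> g"
    and universal_ver: "\<lbrakk>u \<in> Ver C; B \<in> Ob D; vcod C u = onOb G B\<rbrakk>
          \<Longrightarrow> \<exists>!w. w \<in> Ver D \<and> vdom D w = Rob (vdom C u) \<and> vcod D w = B
                \<and> compOb \<eta> (vdom C u) \<cdot>\<^sub>v\<^bsub>C\<^esub> onVer G w = u"
    and universal_sq: "\<lbrakk>a \<in> Sq C; k \<in> Hor D; sqbot C a = onHor G k\<rbrakk>
          \<Longrightarrow> \<exists>!t. t \<in> Sq D \<and> sqtop D t = Rhor (sqtop C a) \<and> sqbot D t = k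
                \<and> compHor \<eta> (sqtop C a) \<star>\<^sub>v\<^bsub>C\<^esub> onSq G t = a"
begin

sublocale ver: universal_arrows "Ob C" "Ver C" "vdom C" "vcod C" "vid C" "vcomp C"
    "Ob D" "Ver D" "vdom D" "vcod D" "vid D" "vcomp D" "onOb G" "onVer G" Rob "compOb \<eta>"
  by (intro universal_arrows.intro universal_arrows_axioms.intro G.target.vcat G.source.vcat
      G.onOb_closed G.onVer_closed G.vdom_onVer G.vcod_onVer G.onVer_vid G.onVer_vcomp
      Rob_closed eta_ob vdom_eta vcod_eta universal_ver)

sublocale sq: universal_arrows "Hor C" "Sq C" "sqtop C" "sqbot C" "sqvid C" "sqvcomp C"
    "Hor D" "Sq D" "sqtop D" "sqbot D" "sqvid D" "sqvcomp D" "onHor G" "onSq G" Rhor "compHor \<eta>"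
  by (intro universal_arrows.intro universal_arrows_axioms.intro G.target.sqvcat G.source.sqvcat
      G.onHor_closed G.onSq_closed G.sqtop_onSq G.sqbot_onSq G.onSq_sqvid G.onSq_sqvcomp
      Rhor_closed eta_hor sqtop_eta sqbot_eta universal_sq)

definition left_adj :: "('o, 'h, 'v, 's, 'p, 'k, 'w, 't) dblfun" where
  "left_adj = \<lparr>onOb = Rob, onHor = Rhor, onVer = ver.R1, onSq = sq.R1\<rparr>"

definition counit :: "('p, 'k, 'w, 't) vtrans" where
  "counit = \<lparr>compOb = ver.counit, compHor = sq.counit\<rparr>"

lemmas base_simps = G.source.closure_simps G.target.closure_simps
  ver.G_simps ver.eta_simps ver.R_simps ver.counit_simps
  sq.G_simps sq.eta_simps sq.R_simps sq.counit_simps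
  Rhor_closed hdom_Rhor hcod_Rhor Rhor_hid Rhor_hcomp sqleft_eta sqright_eta eta_hid eta_hcomp
  G.hdom_onHor G.hcod_onHor G.sqleft_onSq G.sqright_onSq G.onHor_hid G.onHor_hcomp
  G.onSq_sqhid G.onSq_sqhcomp

lemmas corners = G.source.corner_simps G.target.corner_simps

text \<open>Taking left sides in the naturality equation for squares gives the equation that
  characterizes \<open>ver.R1\<close>.\<close>

lemma sqleft_R1:
  assumes "a \<in> Sq C"
  shows "sqleft D (sq.R1 a) = ver.R1 (sqleft C a)"
proof (rule ver.R1_unique[symmetric])
  show "compOb \<eta> (vdom C (sqleft C a)) \<cdot>\<^sub>v\<^bsub>C\<^esub> onVer G (sqleft D (sq.R1 a))
      = sqleft C a \<cdot>\<^sub>v\<^bsub>C\<^esub> compOb \<eta> (vcod C (sqleft C a))"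
    using arg_cong[OF sq.eta_natural[OF assms], of "sqleft C"] assms
    by (simp add: base_simps corners)
qed (use assms in \<open>simp_all add: base_simps corners\<close>)

lemma sqright_R1:
  assumes "a \<in> Sq C"
  shows "sqright D (sq.R1 a) = ver.R1 (sqright C a)"
proof (rule ver.R1_unique[symmetric])
  show "compOb \<eta> (vdom C (sqright C a)) \<cdot>\<^sub>v\<^bsub>C\<^esub> onVer G (sqright D (sq.R1 a))
      = sqright C a \<cdot>\<^sub>v\<^bsub>C\<^esub> compOb \<eta> (vcod C (sqright C a))"
    using arg_cong[OF sq.eta_natural[OF assms], of "sqright C"] assms
    by (simp add: base_simps corners)
qed (use assms in \<open>simp_all add: base_simps corners\<close>)

lemma sqleft_counit:
  assumes "g \<in> Hor D"
  shows "sqleft D (sq.counit g) = ver.counit (hdom D g)"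
proof (rule ver.counit_unique[symmetric])
  show "compOb \<eta> (onOb G (hdom D g)) \<cdot>\<^sub>v\<^bsub>C\<^esub> onVer G (sqleft D (sq.counit g))
      = vid C (onOb G (hdom D g))"
    using arg_cong[OF sq.triangle_right[OF assms], of "sqleft C"] assms
    by (simp add: base_simps corners)
qed (use assms in \<open>simp_all add: base_simps corners\<close>)

lemma sqright_counit:
  assumes "g \<in> Hor D"
  shows "sqright D (sq.counit g) = ver.counit (hcod D g)"
proof (rule ver.counit_unique[symmetric])
  show "compOb \<eta> (onOb G (hcod D g)) \<cdot>\<^sub>v\<^bsub>C\<^esub> onVer G (sqright D (sq.counit g))
      = vid C (onOb G (hcod D g))"
    using arg_cong[OF sq.triangle_right[OF assms], of "sqright C"] assms
    by (simp add: base_simps corners)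
qed (use assms in \<open>simp_all add: base_simps corners\<close>)

lemmas all_simps = base_simps corners sqleft_R1 sqright_R1 sqleft_counit sqright_counit

lemma R1_sqhid:
  assumes "u \<in> Ver C"
  shows "sq.R1 (sqhid C u) = sqhid D (ver.R1 u)"
  by (rule sq.R1_unique)
    (use assms in \<open>simp_all add: all_simps ver.eta_natural G.target.sqhid_vcomp[symmetric]\<close>)

text \<open>Interchange splits the required equation into the naturality equations of the two
  factors, placed side by side.\<close>

lemma R1_sqhcomp:
  assumes "a \<in> Sq C" "b \<in> Sq C" "sqright C a = sqleft C b"
  shows "sq.R1 (a \<star>\<^sub>h\<^bsub>C\<^esub> b) = sq.R1 a \<star>\<^sub>h\<^bsub>D\<^esub> sq.R1 b"
proof (rule sq.R1_unique)
  have c: "hcod C (sqtop C a) = hdom C (sqtop C b)" "hcod C (sqbot C a) = hdom C (sqbot C b)"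
    using assms G.target.corner_simps(1,3)[of b] G.target.corner_simps(2,4)[of a] by simp_all
  show "sqtop D (sq.R1 a \<star>\<^sub>h\<^bsub>D\<^esub> sq.R1 b) = Rhor (sqtop C (a \<star>\<^sub>h\<^bsub>C\<^esub> b))"
    "sqbot D (sq.R1 a \<star>\<^sub>h\<^bsub>D\<^esub> sq.R1 b) = Rhor (sqbot C (a \<star>\<^sub>h\<^bsub>C\<^esub> b))"
    using assms c by (simp_all add: all_simps)
  show "compHor \<eta> (sqtop C (a \<star>\<^sub>h\<^bsub>C\<^esub> b)) \<star>\<^sub>v\<^bsub>C\<^esub> onSq G (sq.R1 a \<star>\<^sub>h\<^bsub>D\<^esub> sq.R1 b)
      = (a \<star>\<^sub>h\<^bsub>C\<^esub> b) \<star>\<^sub>v\<^bsub>C\<^esub> compHor \<eta> (sqbot C (a \<star>\<^sub>h\<^bsub>C\<^esub> b))"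
    using assms c by (simp add: all_simps G.target.interchange sq.eta_natural)
qed (use assms in \<open>simp_all add: all_simps\<close>)

lemma counit_hid:
  assumes "B \<in> Ob D"
  shows "sq.counit (hid D B) = sqhid D (ver.counit B)"
  by (rule sq.counit_unique)
    (use assms in \<open>simp_all add: all_simps ver.triangle_right G.target.sqhid_vcomp[symmetric]
      G.target.sqhid_vid[symmetric]\<close>)

lemma counit_hcomp:
  assumes "f \<in> Hor D" "g \<in> Hor D" "hcod D f = hdom D g"
  shows "sq.counit (f \<cdot>\<^sub>h\<^bsub>D\<^esub> g) = sq.counit f \<star>\<^sub>h\<^bsub>D\<^esub> sq.counit g"
  by (rule sq.counit_unique)
    (use assms in \<open>simp_all add: all_simps G.target.interchange sq.triangle_right
      G.target.sqvid_hcomp\<close>)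

lemma left_adj_functor: "double_functor C D left_adj"
  by (intro double_functor.intro double_functor_axioms.intro G.source.double_category_axioms
      G.target.double_category_axioms)
    (simp_all add: left_adj_def all_simps R1_sqhid R1_sqhcomp ver.R1_ide ver.R1_comp
      sq.R1_ide sq.R1_comp)

theorem vertical_adjunction: "vertical_double_adjunction C D left_adj G \<eta> counit"
proof (intro vertical_double_adjunction.intro vertical_double_adjunction_axioms.intro
    vertical_transformation.intro vertical_transformation_axioms.intro
    left_adj_functor G.double_functor_axioms dblfun_id_functor G.source.double_category_axioms
    G.target.double_category_axioms dblfun_comp_functor[OF left_adj_functor G.double_functor_axioms]
    dblfun_comp_functor[OF G.double_functor_axioms left_adj_functor])
qed (simp_all add: all_simps left_adj_def counit_def dblfun_id_def dblfun_comp_def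
      counit_hid counit_hcomp ver.eta_natural sq.eta_natural ver.counit_natural sq.counit_natural
      ver.triangle_left sq.triangle_left ver.triangle_right sq.triangle_right)

end

section \<open>Double categories of endomorphisms and monads\<close>

lemma endo_double_category_simps [simp]:
  "Ob (endo_double_category_on D p E H V) = E"
  "Hor (endo_double_category_on D p E H V) = H"
  "Ver (endo_double_category_on D p E H V) = V"
  "Sq (endo_double_category_on D p E H V) = endo_squares D H V"
  "hdom (endo_double_category_on D p E H V) = hsrc"
  "hcod (endo_double_category_on D p E H V) = htgt"
  "vdom (endo_double_category_on D p E H V) = vsrc"
  "vcod (endo_double_category_on D p E H V) = vtgt"
  "sqtop (endo_double_category_on D p E H V) = ftop"
  "sqbot (endo_double_category_on D p E H V) = fbot"
  "sqleft (endo_double_category_on D p E H V) = fleft"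
  "sqright (endo_double_category_on D p E H V) = fright"
  "hid (endo_double_category_on D p E H V) = hmap_id (horizontal_two_category D) p"
  "vid (endo_double_category_on D p E H V)
     = (\<lambda>e. VMap e e (vid D (eob (p e))) (sqvid D (emor (p e))))"
  "hcomp (endo_double_category_on D p E H V) = hmap_comp (horizontal_two_category D)"
  "vcomp (endo_double_category_on D p E H V)
     = (\<lambda>w w'. VMap (vsrc w) (vtgt w') (vund w \<cdot>\<^sub>v\<^bsub>D\<^esub> vund w') (vsq w \<star>\<^sub>v\<^bsub>D\<^esub> vsq w'))"
  "sqhid (endo_double_category_on D p E H V)
     = (\<lambda>w. Framed (hmap_id (horizontal_two_category D) p (vsrc w))
          (hmap_id (horizontal_two_category D) p (vtgt w)) w w (sqhid D (vund w)))"
  "sqvid (endo_double_category_on D p E H V)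
     = (\<lambda>h. Framed h h (VMap (hsrc h) (hsrc h) (vid D (eob (p (hsrc h)))) (sqvid D (emor (p (hsrc h)))))
          (VMap (htgt h) (htgt h) (vid D (eob (p (htgt h)))) (sqvid D (emor (p (htgt h)))))
          (sqvid D (hund h)))"
  "sqhcomp (endo_double_category_on D p E H V)
     = (\<lambda>a b. Framed (hmap_comp (horizontal_two_category D) (ftop a) (ftop b))
          (hmap_comp (horizontal_two_category D) (fbot a) (fbot b))
          (fleft a) (fright b) (fcell a \<star>\<^sub>h\<^bsub>D\<^esub> fcell b))"
  "sqvcomp (endo_double_category_on D p E H V)
     = (\<lambda>a b. Framed (ftop a) (fbot b)
          (VMap (vsrc (fleft a)) (vtgt (fleft b)) (vund (fleft a) \<cdot>\<^sub>v\<^bsub>D\<^esub> vund (fleft b))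
             (vsq (fleft a) \<star>\<^sub>v\<^bsub>D\<^esub> vsq (fleft b)))
          (VMap (vsrc (fright a)) (vtgt (fright b)) (vund (fright a) \<cdot>\<^sub>v\<^bsub>D\<^esub> vund (fright b))
             (vsq (fright a) \<star>\<^sub>v\<^bsub>D\<^esub> vsq (fright b)))
          (fcell a \<star>\<^sub>v\<^bsub>D\<^esub> fcell b))"
  by (simp_all add: endo_double_category_on_def Let_def)

lemma hmap_comp_sel [simp]:
  "hsrc (hmap_comp K h h') = hsrc h" "htgt (hmap_comp K h h') = htgt h'"
  "hund (hmap_comp K h h') = hund h \<cdot>\<^bsub>K\<^esub> hund h'"
  "hcell (hmap_comp K h h') = (id2 K (hund h) \<star>\<^bsub>K\<^esub> hcell h') \<bullet>\<^bsub>K\<^esub> (hcell h \<star>\<^bsub>K\<^esub> id2 K (hund h'))"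
  by (simp_all add: hmap_comp_def)

lemma hmap_id_sel [simp]:
  "hsrc (hmap_id K p e) = e" "htgt (hmap_id K p e) = e"
  "hund (hmap_id K p e) = id1 K (eob (p e))" "hcell (hmap_id K p e) = id2 K (emor (p e))"
  by (simp_all add: hmap_id_def)

text \<open>Horizontal maps enter as a category already known, because the 2-categories of the
  hypothesis supply it; vertical maps only need identities and composites to stay in
  \<open>V\<close>.\<close>

locale endo_structures =
  double_category D
  for D :: "('o, 'h, 'v, 's) dblcat" (structure) +
  fixes p :: "'e \<Rightarrow> ('o, 'h) endo" and E :: "'e set" and H :: "('e, 'h, 's) hmap set"
    and V :: "('e, 'v, 's) vmap set"
  assumes endos: "e \<in> E \<Longrightarrow> p e \<in> endos HD"
    and hmaps: "h \<in> H \<Longrightarrow> h \<in> endo_hmaps HD p E"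
    and vmaps: "w \<in> V \<Longrightarrow> w \<in> endo_vmaps D p E"
    and hmap_cat: "category E H hsrc htgt (hmap_id HD p) (hmap_comp HD)"
    and vmap_id: "e \<in> E \<Longrightarrow> VMap e e (vid D (eob (p e))) (sqvid D (emor (p e))) \<in> V"
    and vmap_comp: "\<lbrakk>w \<in> V; w' \<in> V; vtgt w = vsrc w'\<rbrakk>
          \<Longrightarrow> VMap (vsrc w) (vtgt w') (vund w \<cdot>\<^sub>v\<^bsub>D\<^esub> vund w') (vsq w \<star>\<^sub>v\<^bsub>D\<^esub> vsq w') \<in> V"
begin

sublocale hm: category E H hsrc htgt "hmap_id HD p" "hmap_comp HD"
  by (rule hmap_cat)

lemma endo_simps:
  assumes "e \<in> E"
  shows "eob (p e) \<in> Ob D" "emor (p e) \<in> Hor D"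
    "hdom D (emor (p e)) = eob (p e)" "hcod D (emor (p e)) = eob (p e)"
  using endos[OF assms] by (simp_all add: endos_def)

lemma hmap_simps:
  assumes "h \<in> H"
  shows "hsrc h \<in> E" "htgt h \<in> E" "hund h \<in> Hor D"
    "hdom D (hund h) = eob (p (hsrc h))" "hcod D (hund h) = eob (p (htgt h))"
    "hcell h \<in> Sq D" "sqtop D (hcell h) = hund h \<cdot>\<^sub>h emor (p (htgt h))"
    "sqbot D (hcell h) = emor (p (hsrc h)) \<cdot>\<^sub>h hund h"
    "sqleft D (hcell h) = vid D (eob (p (hsrc h)))"
    "sqright D (hcell h) = vid D (eob (p (htgt h)))"
  using hmaps[OF assms] by (auto simp: endo_hmaps_def Cell2_HD endo_simps closure_simps)

lemma vmap_simps:
  assumes "w \<in> V"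
  shows "vsrc w \<in> E" "vtgt w \<in> E" "vund w \<in> Ver D"
    "vdom D (vund w) = eob (p (vsrc w))" "vcod D (vund w) = eob (p (vtgt w))"
    "vsq w \<in> Sq D" "sqtop D (vsq w) = emor (p (vsrc w))" "sqbot D (vsq w) = emor (p (vtgt w))"
    "sqleft D (vsq w) = vund w" "sqright D (vsq w) = vund w"
  using vmaps[OF assms] by (auto simp: endo_vmaps_def)

lemma square_simps:
  assumes "a \<in> endo_squares D H V"
  shows "ftop a \<in> H" "fbot a \<in> H" "fleft a \<in> V" "fright a \<in> V"
    "hsrc (ftop a) = vsrc (fleft a)" "htgt (ftop a) = vsrc (fright a)"
    "hsrc (fbot a) = vtgt (fleft a)" "htgt (fbot a) = vtgt (fright a)"
    "fcell a \<in> Sq D" "sqtop D (fcell a) = hund (ftop a)" "sqbot D (fcell a) = hund (fbot a)"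
    "sqleft D (fcell a) = vund (fleft a)" "sqright D (fcell a) = vund (fright a)"
  using assms by (simp_all add: endo_squares_def)

lemma square_eq:
  "a \<in> endo_squares D H V \<Longrightarrow> hcell (ftop a) \<star>\<^sub>v (vsq (fleft a) \<star>\<^sub>h fcell a)
     = (fcell a \<star>\<^sub>h vsq (fright a)) \<star>\<^sub>v hcell (fbot a)"
  by (simp add: endo_squares_def)

text \<open>The vertical sides match because both meet the common horizontal map at its source or
  target; rewriting alone does not recover this.\<close>

lemma square_stack:
  assumes "a \<in> endo_squares D H V" "b \<in> endo_squares D H V" "fbot a = ftop b"
  shows "vtgt (fleft a) = vsrc (fleft b)" "vtgt (fright a) = vsrc (fright b)"
  using assms by (simp_all add: endo_squares_def)

lemma hmap_unit:
  "\<lbrakk>h \<in> H; hsrc h = e\<rbrakk> \<Longrightarrow> hmap_comp HD (hmap_id HD p e) h = h"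
  "\<lbrakk>h \<in> H; htgt h = e\<rbrakk> \<Longrightarrow> hmap_comp HD h (hmap_id HD p e) = h"
  using hm.ide_comp hm.comp_ide by auto

lemmas simps = closure_simps endo_simps hmap_simps vmap_simps square_simps

text \<open>The cell of the composite top map has two layers. The condition on \<open>a\<close>
  carries \<open>a\<close> across the lower layer (fact \<open>1\<close>), the condition on
  \<open>b\<close> carries \<open>b\<close> across the upper one (fact \<open>2\<close>).\<close>

lemma square_hcomp:
  assumes a: "a \<in> endo_squares D H V" and b: "b \<in> endo_squares D H V"
    and ab: "fright a = fleft b"
  shows "Framed (hmap_comp HD (ftop a) (ftop b)) (hmap_comp HD (fbot a) (fbot b))
           (fleft a) (fright b) (fcell a \<star>\<^sub>h fcell b) \<in> endo_squares D H V"
proof -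
  let ?F = "sqvid D (hund (ftop a))" and ?F' = "sqvid D (hund (ftop b))"
    and ?G = "sqvid D (hund (fbot a))" and ?G' = "sqvid D (hund (fbot b))"
    and ?\<phi> = "hcell (ftop a)" and ?\<phi>' = "hcell (ftop b)"
    and ?\<gamma> = "hcell (fbot a)" and ?\<gamma>' = "hcell (fbot b)"
    and ?w = "vsq (fleft a)" and ?w' = "vsq (fleft b)" and ?w'' = "vsq (fright b)"
    and ?a = "fcell a" and ?b = "fcell b"
  note s = a b ab simps
  have "(?\<phi> \<star>\<^sub>h ?F') \<star>\<^sub>v (?w \<star>\<^sub>h (?a \<star>\<^sub>h ?b)) = (?\<phi> \<star>\<^sub>v (?w \<star>\<^sub>h ?a)) \<star>\<^sub>h ?b"
    using interchange[of ?\<phi> ?F' "?w \<star>\<^sub>h ?a" ?b] by (simp add: s sqh.comp_assoc unit_simps)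
  also have "\<dots> = ((?a \<star>\<^sub>h ?w') \<star>\<^sub>h ?b) \<star>\<^sub>v (?\<gamma> \<star>\<^sub>h ?G')"
    using interchange[of "?a \<star>\<^sub>h ?w'" ?b ?\<gamma> ?G']
    by (simp add: s square_eq[OF a] unit_simps)
  finally have 1: "(?\<phi> \<star>\<^sub>h ?F') \<star>\<^sub>v (?w \<star>\<^sub>h (?a \<star>\<^sub>h ?b))
      = (?a \<star>\<^sub>h (?w' \<star>\<^sub>h ?b)) \<star>\<^sub>v (?\<gamma> \<star>\<^sub>h ?G')"
    by (simp add: s sqh.comp_assoc)
  have "(?F \<star>\<^sub>h ?\<phi>') \<star>\<^sub>v (?a \<star>\<^sub>h (?w' \<star>\<^sub>h ?b)) = ?a \<star>\<^sub>h (?\<phi>' \<star>\<^sub>v (?w' \<star>\<^sub>h ?b))"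
    using interchange[of ?F ?\<phi>' ?a "?w' \<star>\<^sub>h ?b"] by (simp add: s unit_simps)
  also have "\<dots> = (?a \<star>\<^sub>h (?b \<star>\<^sub>h ?w'')) \<star>\<^sub>v (?G \<star>\<^sub>h ?\<gamma>')"
    using interchange[of ?a "?b \<star>\<^sub>h ?w''" ?G ?\<gamma>'] by (simp add: s square_eq[OF b] unit_simps)
  finally have 2: "(?F \<star>\<^sub>h ?\<phi>') \<star>\<^sub>v (?a \<star>\<^sub>h (?w' \<star>\<^sub>h ?b))
      = ((?a \<star>\<^sub>h ?b) \<star>\<^sub>h ?w'') \<star>\<^sub>v (?G \<star>\<^sub>h ?\<gamma>')"
    by (simp add: s sqh.comp_assoc)
  have "((?F \<star>\<^sub>h ?\<phi>') \<star>\<^sub>v (?\<phi> \<star>\<^sub>h ?F')) \<star>\<^sub>v (?w \<star>\<^sub>h (?a \<star>\<^sub>h ?b))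
      = (?F \<star>\<^sub>h ?\<phi>') \<star>\<^sub>v ((?a \<star>\<^sub>h (?w' \<star>\<^sub>h ?b)) \<star>\<^sub>v (?\<gamma> \<star>\<^sub>h ?G'))"
    by (simp add: s sqv.comp_assoc hor.comp_assoc 1)
  also have "\<dots> = ((?F \<star>\<^sub>h ?\<phi>') \<star>\<^sub>v (?a \<star>\<^sub>h (?w' \<star>\<^sub>h ?b))) \<star>\<^sub>v (?\<gamma> \<star>\<^sub>h ?G')"
    by (simp add: s sqv.comp_assoc hor.comp_assoc)
  also have "\<dots> = ((?a \<star>\<^sub>h ?b) \<star>\<^sub>h ?w'') \<star>\<^sub>v ((?G \<star>\<^sub>h ?\<gamma>') \<star>\<^sub>v (?\<gamma> \<star>\<^sub>h ?G'))"
    unfolding 2 by (simp add: s sqv.comp_assoc hor.comp_assoc)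
  finally show ?thesis
    unfolding endo_squares_def by (simp add: s hm.comp_closed)
qed

lemma square_vcomp:
  assumes a: "a \<in> endo_squares D H V" and b: "b \<in> endo_squares D H V"
    and ab: "fbot a = ftop b"
  shows "Framed (ftop a) (fbot b)
          (VMap (vsrc (fleft a)) (vtgt (fleft b)) (vund (fleft a) \<cdot>\<^sub>v vund (fleft b))
             (vsq (fleft a) \<star>\<^sub>v vsq (fleft b)))
          (VMap (vsrc (fright a)) (vtgt (fright b)) (vund (fright a) \<cdot>\<^sub>v vund (fright b))
             (vsq (fright a) \<star>\<^sub>v vsq (fright b)))
          (fcell a \<star>\<^sub>v fcell b) \<in> endo_squares D H V"
proof -
  let ?\<phi> = "hcell (ftop a)" and ?\<gamma> = "hcell (ftop b)" and ?\<delta> = "hcell (fbot b)"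
    and ?w = "vsq (fleft a)" and ?x = "vsq (fleft b)"
    and ?w' = "vsq (fright a)" and ?x' = "vsq (fright b)"
    and ?a = "fcell a" and ?b = "fcell b"
  note s = a b ab square_stack[OF a b ab] simps
  have "?\<phi> \<star>\<^sub>v ((?w \<star>\<^sub>v ?x) \<star>\<^sub>h (?a \<star>\<^sub>v ?b)) = (?\<phi> \<star>\<^sub>v (?w \<star>\<^sub>h ?a)) \<star>\<^sub>v (?x \<star>\<^sub>h ?b)"
    by (simp add: s interchange[symmetric] sqv.comp_assoc)
  also have "\<dots> = (?a \<star>\<^sub>h ?w') \<star>\<^sub>v (?\<gamma> \<star>\<^sub>v (?x \<star>\<^sub>h ?b))"
    unfolding square_eq[OF a] by (simp add: s sqv.comp_assoc)
  also have "\<dots> = ((?a \<star>\<^sub>v ?b) \<star>\<^sub>h (?w' \<star>\<^sub>v ?x')) \<star>\<^sub>v ?\<delta>"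
    unfolding square_eq[OF b] by (simp add: s interchange[symmetric] sqv.comp_assoc)
  finally show ?thesis
    unfolding endo_squares_def by (simp add: s vmap_comp)
qed

lemma square_hid:
  assumes "w \<in> V"
  shows "Framed (hmap_id HD p (vsrc w)) (hmap_id HD p (vtgt w)) w w (sqhid D (vund w))
      \<in> endo_squares D H V"
  using assms unfolding endo_squares_def by (simp add: simps hm.ide_closed unit_simps)

lemma square_vid:
  assumes "h \<in> H"
  shows "Framed h h (VMap (hsrc h) (hsrc h) (vid D (eob (p (hsrc h)))) (sqvid D (emor (p (hsrc h)))))
      (VMap (htgt h) (htgt h) (vid D (eob (p (htgt h)))) (sqvid D (emor (p (htgt h)))))
      (sqvid D (hund h)) \<in> endo_squares D H V"
  using assms unfolding endo_squares_def by (simp add: simps vmap_id unit_simps sqvid_hcomp[symmetric])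

theorem double_category_endo: "double_category (endo_double_category_on D p E H V)"
  (is "double_category ?E")
proof (intro double_category.intro category.intro)
  \<comment> \<open>With three stacked squares, the vertical sides match only through the horizontal
    maps between them, so \<open>square_stack\<close> is applied at both interfaces.\<close>
  fix f g h
  assume fgh: "f \<in> Sq ?E" "g \<in> Sq ?E" "h \<in> Sq ?E" and e: "sqbot ?E f = sqtop ?E g" "sqbot ?E g = sqtop ?E h"
  have "f \<in> endo_squares D H V" "g \<in> endo_squares D H V" "h \<in> endo_squares D H V"
    "fbot f = ftop g" "fbot g = ftop h"
    using fgh e by simp_all
  note s = this square_stack[OF this(1,2,4)] square_stack[OF this(2,3,5)]
  show "sqvcomp ?E (sqvcomp ?E f g) h = sqvcomp ?E f (sqvcomp ?E g h)"
    by (simp add: s simps sqv.comp_assoc ver.comp_assoc)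
qed (simp_all add: hm.dom_closed hm.cod_closed hm.ide_closed hm.comp_closed hmap_unit
    hm.comp_assoc simps vmap_id vmap_comp square_hid square_vid square_hcomp square_vcomp unit_simps
    sqh.comp_assoc sqv.comp_assoc ver.comp_assoc interchange sqhid_vid sqhid_vcomp sqvid_hcomp)

end

section \<open>Vertical monad maps and the forgetful double functor\<close>

context double_category
begin

lemma monad_simps:
  assumes "m \<in> monads HD"
  shows "endo_of m \<in> endos HD"
    and "eob (endo_of m) \<in> Ob D" "emor (endo_of m) \<in> Hor D"
    "hdom D (emor (endo_of m)) = eob (endo_of m)" "hcod D (emor (endo_of m)) = eob (endo_of m)"
    "mult m \<in> Sq D" "sqtop D (mult m) = emor (endo_of m) \<cdot>\<^sub>h emor (endo_of m)"
    "sqbot D (mult m) = emor (endo_of m)"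
    "sqleft D (mult m) = vid D (eob (endo_of m))" "sqright D (mult m) = vid D (eob (endo_of m))"
    "munit m \<in> Sq D" "sqtop D (munit m) = hid D (eob (endo_of m))"
    "sqbot D (munit m) = emor (endo_of m)"
    "sqleft D (munit m) = vid D (eob (endo_of m))" "sqright D (munit m) = vid D (eob (endo_of m))"
  using assms by (auto simp: monads_def endos_def Let_def Cell2_HD closure_simps)

lemma monad_vmap_simps:
  assumes "w \<in> monad_vmaps D"
  shows "vsrc w \<in> monads HD" "vtgt w \<in> monads HD" "vund w \<in> Ver D"
    "vdom D (vund w) = eob (endo_of (vsrc w))" "vcod D (vund w) = eob (endo_of (vtgt w))"
    "vsq w \<in> Sq D" "sqtop D (vsq w) = emor (endo_of (vsrc w))"
    "sqbot D (vsq w) = emor (endo_of (vtgt w))"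
    "sqleft D (vsq w) = vund w" "sqright D (vsq w) = vund w"
  using assms by (auto simp: monad_vmaps_def endo_vmaps_def)

lemma monad_vmap_eqs:
  assumes "w \<in> monad_vmaps D"
  shows "munit (vsrc w) \<star>\<^sub>v vsq w = sqhid D (vund w) \<star>\<^sub>v munit (vtgt w)"
    and "mult (vsrc w) \<star>\<^sub>v vsq w = (vsq w \<star>\<^sub>h vsq w) \<star>\<^sub>v mult (vtgt w)"
  using assms by (auto simp: monad_vmaps_def)

lemma monad_vmap_id:
  "m \<in> monads HD \<Longrightarrow> VMap m m (vid D (eob (endo_of m))) (sqvid D (emor (endo_of m))) \<in> monad_vmaps D"
  unfolding monad_vmaps_def endo_vmaps_def
  by (simp add: monad_simps closure_simps unit_simps sqhid_vid sqvid_hcomp[symmetric])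

lemma monad_vmap_comp:
  assumes w: "w \<in> monad_vmaps D" and w': "w' \<in> monad_vmaps D" and c: "vtgt w = vsrc w'"
  shows "VMap (vsrc w) (vtgt w') (vund w \<cdot>\<^sub>v vund w') (vsq w \<star>\<^sub>v vsq w') \<in> monad_vmaps D"
proof -
  let ?w = "vsq w" and ?w' = "vsq w'"
  note s = w w' c monad_vmap_simps monad_simps closure_simps
  have "munit (vsrc w) \<star>\<^sub>v (?w \<star>\<^sub>v ?w') = (munit (vsrc w) \<star>\<^sub>v ?w) \<star>\<^sub>v ?w'"
    by (simp add: s sqv.comp_assoc)
  also have "\<dots> = sqhid D (vund w) \<star>\<^sub>v (munit (vsrc w') \<star>\<^sub>v ?w')"
    unfolding monad_vmap_eqs[OF w] by (simp add: s sqv.comp_assoc)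
  also have "\<dots> = sqhid D (vund w \<cdot>\<^sub>v vund w') \<star>\<^sub>v munit (vtgt w')"
    unfolding monad_vmap_eqs[OF w'] by (simp add: s sqv.comp_assoc sqhid_vcomp)
  finally have 1: "munit (vsrc w) \<star>\<^sub>v (?w \<star>\<^sub>v ?w')
      = sqhid D (vund w \<cdot>\<^sub>v vund w') \<star>\<^sub>v munit (vtgt w')" .
  have "mult (vsrc w) \<star>\<^sub>v (?w \<star>\<^sub>v ?w') = (mult (vsrc w) \<star>\<^sub>v ?w) \<star>\<^sub>v ?w'"
    by (simp add: s sqv.comp_assoc)
  also have "\<dots> = (?w \<star>\<^sub>h ?w) \<star>\<^sub>v (mult (vsrc w') \<star>\<^sub>v ?w')"
    unfolding monad_vmap_eqs[OF w] by (simp add: s sqv.comp_assoc)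
  also have "\<dots> = ((?w \<star>\<^sub>v ?w') \<star>\<^sub>h (?w \<star>\<^sub>v ?w')) \<star>\<^sub>v mult (vtgt w')"
    unfolding monad_vmap_eqs[OF w'] by (simp add: s sqv.comp_assoc interchange[symmetric])
  finally have 2: "mult (vsrc w) \<star>\<^sub>v (?w \<star>\<^sub>v ?w')
      = ((?w \<star>\<^sub>v ?w') \<star>\<^sub>h (?w \<star>\<^sub>v ?w')) \<star>\<^sub>v mult (vtgt w')" .
  show ?thesis
    unfolding monad_vmaps_def endo_vmaps_def using 1 2 by (simp add: s)
qed

text \<open>Identities and composites of horizontal maps are read off from the 1-cells of the
  2-category, which leaves the vertical maps to check.\<close>

lemma End_structures:
  assumes "two_category (End2 HD)"
  shows "endo_structures D id (endos HD) (endo_hmaps HD id (endos HD)) (endo_vmaps D id (endos HD))"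
proof (intro endo_structures.intro endo_structures_axioms.intro double_category_axioms)
  show "category (endos HD) (endo_hmaps HD id (endos HD)) hsrc htgt (hmap_id HD id) (hmap_comp HD)"
    using two_category.cat1[OF assms] by (simp add: End2_def endo_two_category_on_def)
qed (auto simp: endo_vmaps_def endos_def closure_simps)

lemma Mnd_structures:
  assumes "two_category (Mnd2 HD)"
  shows "endo_structures D endo_of (monads HD) (monad_hmaps HD) (monad_vmaps D)"
proof (intro endo_structures.intro endo_structures_axioms.intro double_category_axioms)
  show "category (monads HD) (monad_hmaps HD) hsrc htgt (hmap_id HD endo_of) (hmap_comp HD)"
    using two_category.cat1[OF assms] by (simp add: Mnd2_def endo_two_category_on_def)
qed (auto simp: monad_simps monad_hmaps_def monad_vmap_id monad_vmap_comp, simp add: monad_vmaps_def)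

lemma forgetD_functor:
  assumes "two_category (End2 HD)" "two_category (Mnd2 HD)"
  shows "double_functor (MndD D) (EndD D) forgetD"
proof -
  interpret E: endo_structures D id "endos HD" "endo_hmaps HD id (endos HD)" "endo_vmaps D id (endos HD)"
    by (rule End_structures[OF assms(1)])
  interpret M: endo_structures D endo_of "monads HD" "monad_hmaps HD" "monad_vmaps D"
    by (rule Mnd_structures[OF assms(2)])
  have h: "map_hmap endo_of id id h \<in> endo_hmaps HD id (endos HD)" if "h \<in> monad_hmaps HD" for h
    using M.hmaps[OF that] M.endos by (auto simp: endo_hmaps_def hmap.map_sel)
  have v: "map_vmap endo_of id id w \<in> endo_vmaps D id (endos HD)" if "w \<in> monad_vmaps D" for w
    using M.vmaps[OF that] M.endos by (auto simp: endo_vmaps_def vmap.map_sel)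
  have s: "map_framed (map_hmap endo_of id id) (map_vmap endo_of id id) id a
      \<in> endo_squares D (endo_hmaps HD id (endos HD)) (endo_vmaps D id (endos HD))"
    if "a \<in> endo_squares D (monad_hmaps HD) (monad_vmaps D)" for a
    using that h v by (auto simp: endo_squares_def framed.map_sel hmap.map_sel vmap.map_sel)
  show ?thesis
    unfolding MndD_def EndD_def Let_def
    by (intro double_functor.intro double_functor_axioms.intro M.double_category_endo
        E.double_category_endo)
      (simp_all add: forgetD_def h v s M.endos framed.map_sel hmap.map_sel vmap.map_sel
        hmap_id_def hmap_comp_def)
qed

end

section \<open>Cofoldings\<close>

lemma inverse_quintets_simps [simp]:
  "Ob (inverse_quintets K) = Cell0 K" "Hor (inverse_quintets K) = Cell1 K"
  "Ver (inverse_quintets K) = Cell1 K"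
  "hdom (inverse_quintets K) = dom1 K" "hcod (inverse_quintets K) = cod1 K"
  "vdom (inverse_quintets K) = cod1 K" "vcod (inverse_quintets K) = dom1 K"
  "sqtop (inverse_quintets K) = ftop" "sqbot (inverse_quintets K) = fbot"
  "sqleft (inverse_quintets K) = fleft" "sqright (inverse_quintets K) = fright"
  "hid (inverse_quintets K) = id1 K" "vid (inverse_quintets K) = id1 K"
  "vcomp (inverse_quintets K) = (\<lambda>j j'. j' \<cdot>\<^bsub>K\<^esub> j)"
  by (simp_all add: inverse_quintets_def)

context cofolding
begin

text \<open>The boundary of \<open>onSq \<Lambda> a\<close> is determined by that of
  \<open>a\<close>, so only its cell carries information.\<close>

definition fold_cell :: "'s \<Rightarrow> 's" where
  "fold_cell a = fcell (onSq \<Lambda> a)"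

lemma star_simps:
  assumes "u \<in> Ver D"
  shows "onVer \<Lambda> u \<in> Hor D" "hdom D (onVer \<Lambda> u) = vcod D u" "hcod D (onVer \<Lambda> u) = vdom D u"
  using onVer_closed[OF assms] vcod_onVer[OF assms] vdom_onVer[OF assms] assms
  by (simp_all add: onOb_eq source.closure_simps)

lemma star_vid: "A \<in> Ob D \<Longrightarrow> onVer \<Lambda> (vid D A) = hid D A"
  using onVer_vid[of A] by (simp add: onOb_eq)

lemma star_vcomp:
  "\<lbrakk>u \<in> Ver D; v \<in> Ver D; vcod D u = vdom D v\<rbrakk>
    \<Longrightarrow> onVer \<Lambda> (u \<cdot>\<^sub>v\<^bsub>D\<^esub> v) = onVer \<Lambda> v \<cdot>\<^sub>h\<^bsub>D\<^esub> onVer \<Lambda> u"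
  using onVer_vcomp[of u v] by simp

lemma onSq_sides:
  assumes "a \<in> Sq D"
  shows "ftop (onSq \<Lambda> a) = sqtop D a" "fbot (onSq \<Lambda> a) = sqbot D a"
    "fleft (onSq \<Lambda> a) = onVer \<Lambda> (sqleft D a)" "fright (onSq \<Lambda> a) = onVer \<Lambda> (sqright D a)"
  using sqtop_onSq[OF assms] sqbot_onSq[OF assms] sqleft_onSq[OF assms] sqright_onSq[OF assms] assms
  by (simp_all add: onHor_eq source.closure_simps)

lemma onSq_Framed:
  "a \<in> Sq D \<Longrightarrow> onSq \<Lambda> a
     = Framed (sqtop D a) (sqbot D a) (onVer \<Lambda> (sqleft D a)) (onVer \<Lambda> (sqright D a)) (fold_cell a)"
  by (simp add: framed.expand fold_cell_def onSq_sides)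

lemma fold_cell_simps:
  assumes a: "a \<in> Sq D"
  shows "fold_cell a \<in> Sq D"
    and "sqtop D (fold_cell a) = onVer \<Lambda> (sqleft D a) \<cdot>\<^sub>h\<^bsub>D\<^esub> sqtop D a"
    and "sqbot D (fold_cell a) = sqbot D a \<cdot>\<^sub>h\<^bsub>D\<^esub> onVer \<Lambda> (sqright D a)"
    and "sqleft D (fold_cell a) = vid D (hdom D (sqbot D a))"
    and "sqright D (fold_cell a) = vid D (hcod D (sqtop D a))"
proof -
  have "fold_cell a \<in> Cell2 source.HD" and
    1: "sqtop D (fold_cell a) = onVer \<Lambda> (sqleft D a) \<cdot>\<^sub>h\<^bsub>D\<^esub> sqtop D a"
      "sqbot D (fold_cell a) = sqbot D a \<cdot>\<^sub>h\<^bsub>D\<^esub> onVer \<Lambda> (sqright D a)"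
    using onSq_closed[OF a] a by (simp_all add: inverse_quintets_def onSq_Framed)
  with a show "fold_cell a \<in> Sq D"
    "sqleft D (fold_cell a) = vid D (hdom D (sqbot D a))"
    "sqright D (fold_cell a) = vid D (hcod D (sqtop D a))"
    by (simp_all add: source.Cell2_HD source.closure_simps star_simps source.corner_simps)
  show "sqtop D (fold_cell a) = onVer \<Lambda> (sqleft D a) \<cdot>\<^sub>h\<^bsub>D\<^esub> sqtop D a"
    "sqbot D (fold_cell a) = sqbot D a \<cdot>\<^sub>h\<^bsub>D\<^esub> onVer \<Lambda> (sqright D a)"
    by (fact 1)+
qed

lemma fold_cell_hcomp:
  assumes "a \<in> Sq D" "b \<in> Sq D" "sqright D a = sqleft D b"
  shows "fold_cell (a \<star>\<^sub>h\<^bsub>D\<^esub> b)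
    = (fold_cell a \<star>\<^sub>h\<^bsub>D\<^esub> sqvid D (sqtop D b)) \<star>\<^sub>v\<^bsub>D\<^esub> (sqvid D (sqbot D a) \<star>\<^sub>h\<^bsub>D\<^esub> fold_cell b)"
  using onSq_sqhcomp[OF assms] assms
  by (simp add: onSq_Framed inverse_quintets_def source.closure_simps)

lemma fold_cell_vcomp:
  assumes "a \<in> Sq D" "b \<in> Sq D" "sqbot D a = sqtop D b"
  shows "fold_cell (a \<star>\<^sub>v\<^bsub>D\<^esub> b)
    = (sqvid D (onVer \<Lambda> (sqleft D b)) \<star>\<^sub>h\<^bsub>D\<^esub> fold_cell a)
        \<star>\<^sub>v\<^bsub>D\<^esub> (fold_cell b \<star>\<^sub>h\<^bsub>D\<^esub> sqvid D (onVer \<Lambda> (sqright D a)))"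
  using onSq_sqvcomp[OF assms] assms
  by (simp add: onSq_Framed inverse_quintets_def source.closure_simps)

lemma fold_cell_sqhid: "u \<in> Ver D \<Longrightarrow> fold_cell (sqhid D u) = sqvid D (onVer \<Lambda> u)"
  using onSq_sqhid[of u] by (simp add: onSq_Framed inverse_quintets_def source.closure_simps)

text \<open>Multiplications, units and cells of horizontal maps have identity vertical sides, so
  they survive unchanged when an equation is folded.\<close>

lemma fold_cell_id:
  "\<lbrakk>a \<in> Sq D; sqleft D a = vid D A; sqright D a = vid D B; A \<in> Ob D; B \<in> Ob D\<rbrakk>
    \<Longrightarrow> fold_cell a = a"
  using onSq_eq[of a] by (auto simp: fold_cell_def horizontal_two_category_def)

lemma fold_cell_inj:
  assumes "a \<in> Sq D" "b \<in> Sq D" "sqtop D a = sqtop D b" "sqbot D a = sqbot D b"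
    "sqleft D a = sqleft D b" "sqright D a = sqright D b" "fold_cell a = fold_cell b"
  shows "a = b"
  using fully_faithful[of "sqtop D b" "sqbot D b" "sqleft D b" "sqright D b"] assms
  by (auto simp: bij_betw_def inj_on_def onSq_Framed source.closure_simps source.corner_simps)

lemma fold_cell_surj:
  assumes "f \<in> Hor D" "g \<in> Hor D" "j \<in> Ver D" "k \<in> Ver D"
    and "hdom D f = vdom D j" "hcod D f = vdom D k" "hdom D g = vcod D j" "hcod D g = vcod D k"
    and "c \<in> Cell2 source.HD" "sqtop D c = onVer \<Lambda> j \<cdot>\<^sub>h\<^bsub>D\<^esub> f" "sqbot D c = g \<cdot>\<^sub>h\<^bsub>D\<^esub> onVer \<Lambda> k"
  obtains a where "a \<in> Sq D" "sqtop D a = f" "sqbot D a = g" "sqleft D a = j" "sqright D a = k"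
    "fold_cell a = c"
proof -
  have "Framed f g (onVer \<Lambda> j) (onVer \<Lambda> k) c \<in> {s \<in> Sq (inverse_quintets source.HD).
      ftop s = f \<and> fbot s = g \<and> fleft s = onVer \<Lambda> j \<and> fright s = onVer \<Lambda> k}"
    using assms by (simp add: inverse_quintets_def star_simps)
  then obtain a where "a \<in> Sq D" "sqtop D a = f" "sqbot D a = g" "sqleft D a = j" "sqright D a = k"
    "onSq \<Lambda> a = Framed f g (onVer \<Lambda> j) (onVer \<Lambda> k) c"
    using fully_faithful[OF assms(1-8)] unfolding bij_betw_def by (auto elim!: equalityE)
  then show thesis
    by (intro that) (auto simp: fold_cell_def)
qed

definition hmap_of :: "('e, 'v, 's) vmap \<Rightarrow> ('e, 'h, 's) hmap" where
  "hmap_of w = HMap (vtgt w) (vsrc w) (onVer \<Lambda> (vund w)) (fold_cell (vsq w))"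

lemma hmap_of_sel [simp]:
  "hsrc (hmap_of w) = vtgt w" "htgt (hmap_of w) = vsrc w" "hund (hmap_of w) = onVer \<Lambda> (vund w)"
  "hcell (hmap_of w) = fold_cell (vsq w)"
  by (simp_all add: hmap_of_def)

lemmas fold_simps = source.closure_simps star_simps star_vid star_vcomp fold_cell_simps

lemma hmap_of_closed:
  assumes "w \<in> endo_vmaps D p E" "p (vsrc w) \<in> endos source.HD" "p (vtgt w) \<in> endos source.HD"
  shows "hmap_of w \<in> endo_hmaps source.HD p E"
  using assms unfolding endo_vmaps_def endo_hmaps_def
  by (auto simp: source.Cell2_HD fold_simps endos_def)

text \<open>Equality of the underlying vertical morphisms is a separate premise because \<Lambda>
  may identify different ones.\<close>

lemma hmap_of_inj:
  assumes "w \<in> endo_vmaps D p E" "w' \<in> endo_vmaps D p E" "vund w = vund w'" "hmap_of w = hmap_of w'"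
  shows "w = w'"
  using assms fold_cell_inj[of "vsq w" "vsq w'"]
  by (intro vmap.expand) (auto simp: hmap_of_def endo_vmaps_def)

text \<open>Fullness unfolds the cell of \<open>h\<close> once a vertical morphism lying over
  \<open>hund h\<close> has been chosen.\<close>

lemma hmap_of_surj:
  assumes "h \<in> endo_hmaps source.HD p E" "u \<in> Ver D" "hund h = onVer \<Lambda> u"
    and "p (hsrc h) \<in> endos source.HD" "p (htgt h) \<in> endos source.HD"
  obtains w where "w \<in> endo_vmaps D p E" "vund w = u" "hmap_of w = h"
proof -
  have u: "vdom D u = eob (p (htgt h))" "vcod D u = eob (p (hsrc h))"
    using assms star_simps[OF assms(2)] by (simp_all add: endo_hmaps_def)
  obtain a where a: "a \<in> Sq D" "sqtop D a = emor (p (htgt h))" "sqbot D a = emor (p (hsrc h))"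
    "sqleft D a = u" "sqright D a = u" "fold_cell a = hcell h"
    by (rule fold_cell_surj[of "emor (p (htgt h))" "emor (p (hsrc h))" u u "hcell h"])
      (use assms u in \<open>auto simp: endo_hmaps_def endos_def\<close>)
  show thesis
    by (rule that[of "VMap (htgt h) (hsrc h) u a"])
      (use assms u a in \<open>auto simp: endo_vmaps_def endo_hmaps_def hmap_of_def hmap.expand\<close>)
qed

lemma hmap_of_vcomp:
  assumes "w \<in> endo_vmaps D p E" "w' \<in> endo_vmaps D p E" "vtgt w = vsrc w'"
  shows "hmap_of (VMap (vsrc w) (vtgt w') (vund w \<cdot>\<^sub>v\<^bsub>D\<^esub> vund w') (vsq w \<star>\<^sub>v\<^bsub>D\<^esub> vsq w'))
    = hmap_comp source.HD (hmap_of w') (hmap_of w)"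
  using assms by (simp add: endo_vmaps_def hmap_of_def hmap_comp_def fold_cell_vcomp star_vcomp)

text \<open>The two sides of each vertical law share their boundary, so the law can be tested after
  folding. Structure cells stay fixed and \<open>sqhid D (vund w)\<close> becomes an identity
  2-cell; what remains is the horizontal law for the reversed map.\<close>

lemma hmap_of_monad:
  assumes w: "w \<in> endo_vmaps D endo_of (monads source.HD)"
  shows "hmap_of w \<in> monad_hmaps source.HD \<longleftrightarrow> w \<in> monad_vmaps D"
proof -
  let ?w = "vsq w" and ?S = "vsrc w" and ?T = "vtgt w" and ?u = "vund w"
  have w': "vsrc w \<in> monads source.HD" "vtgt w \<in> monads source.HD" "vund w \<in> Ver D"
    "vdom D (vund w) = eob (endo_of (vsrc w))" "vcod D (vund w) = eob (endo_of (vtgt w))"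
    "vsq w \<in> Sq D" "sqtop D (vsq w) = emor (endo_of (vsrc w))"
    "sqbot D (vsq w) = emor (endo_of (vtgt w))"
    "sqleft D (vsq w) = vund w" "sqright D (vsq w) = vund w"
    using w by (auto simp: endo_vmaps_def)
  note s = w' source.monad_simps fold_simps
  have id: "fold_cell (munit m) = munit m" "fold_cell (mult m) = mult m" if "m \<in> monads source.HD" for m
    using that by (auto intro!: fold_cell_id simp: source.monad_simps)
  have "munit ?S \<star>\<^sub>v\<^bsub>D\<^esub> ?w = sqhid D ?u \<star>\<^sub>v\<^bsub>D\<^esub> munit ?T
      \<longleftrightarrow> fold_cell (munit ?S \<star>\<^sub>v\<^bsub>D\<^esub> ?w) = fold_cell (sqhid D ?u \<star>\<^sub>v\<^bsub>D\<^esub> munit ?T)"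
    by (auto intro: fold_cell_inj simp: s source.unit_simps)
  also have "\<dots> \<longleftrightarrow> (sqvid D (onVer \<Lambda> ?u) \<star>\<^sub>h\<^bsub>D\<^esub> munit ?S) \<star>\<^sub>v\<^bsub>D\<^esub> fold_cell ?w
      = munit ?T \<star>\<^sub>h\<^bsub>D\<^esub> sqvid D (onVer \<Lambda> ?u)"
    by (simp add: s id fold_cell_vcomp fold_cell_sqhid source.sqvid_hid_unit source.unit_simps)
  finally have 1: "munit ?S \<star>\<^sub>v\<^bsub>D\<^esub> ?w = sqhid D ?u \<star>\<^sub>v\<^bsub>D\<^esub> munit ?T \<longleftrightarrow> \<dots>" .
  have "mult ?S \<star>\<^sub>v\<^bsub>D\<^esub> ?w = (?w \<star>\<^sub>h\<^bsub>D\<^esub> ?w) \<star>\<^sub>v\<^bsub>D\<^esub> mult ?T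
      \<longleftrightarrow> fold_cell (mult ?S \<star>\<^sub>v\<^bsub>D\<^esub> ?w) = fold_cell ((?w \<star>\<^sub>h\<^bsub>D\<^esub> ?w) \<star>\<^sub>v\<^bsub>D\<^esub> mult ?T)"
    by (auto intro: fold_cell_inj simp: s source.unit_simps)
  also have "\<dots> \<longleftrightarrow> (sqvid D (onVer \<Lambda> ?u) \<star>\<^sub>h\<^bsub>D\<^esub> mult ?S) \<star>\<^sub>v\<^bsub>D\<^esub> fold_cell ?w
      = (fold_cell ?w \<star>\<^sub>h\<^bsub>D\<^esub> sqvid D (emor (endo_of ?S)))
        \<star>\<^sub>v\<^bsub>D\<^esub> (sqvid D (emor (endo_of ?T)) \<star>\<^sub>h\<^bsub>D\<^esub> fold_cell ?w)
        \<star>\<^sub>v\<^bsub>D\<^esub> (mult ?T \<star>\<^sub>h\<^bsub>D\<^esub> sqvid D (onVer \<Lambda> ?u))"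
    by (simp add: s id fold_cell_vcomp fold_cell_hcomp source.sqvid_hid_unit source.unit_simps source.sqv.comp_assoc
        source.hor.comp_assoc)
  finally have 2: "mult ?S \<star>\<^sub>v\<^bsub>D\<^esub> ?w = (?w \<star>\<^sub>h\<^bsub>D\<^esub> ?w) \<star>\<^sub>v\<^bsub>D\<^esub> mult ?T \<longleftrightarrow> \<dots>" .
  show ?thesis
    using w hmap_of_closed[OF w] w' 1 2
    by (simp add: monad_hmaps_def monad_vmaps_def Let_def source.monad_simps)
qed

end

locale cofolded_endo_structures =
  endo_structures D p E H V + cofolding D \<Lambda>
  for D :: "('o, 'h, 'v, 's) dblcat" (structure)
    and p :: "'e \<Rightarrow> ('o, 'h) endo" and E H V and \<Lambda> +
  assumes hmap_of_V: "w \<in> V \<Longrightarrow> hmap_of w \<in> H"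
begin

text \<open>This extends the cofolding to endomorphisms and monads: the folded square condition is,
  up to associativity, the 2-cell condition between the two composites around the boundary.\<close>

lemma square_iff:
  assumes "h \<in> H" "h' \<in> H" "w \<in> V" "w' \<in> V"
    and "hsrc h = vsrc w" "htgt h = vsrc w'" "hsrc h' = vtgt w" "htgt h' = vtgt w'"
    and "a \<in> Sq D" "sqtop D a = hund h" "sqbot D a = hund h'"
    and "sqleft D a = vund w" "sqright D a = vund w'"
  shows "Framed h h' w w' a \<in> endo_squares D H V
    \<longleftrightarrow> MapCell (hmap_comp HD (hmap_of w) h) (hmap_comp HD h' (hmap_of w')) (fold_cell a)
          \<in> endo_cells HD p H"
proof -
  note s = assms closure_simps endo_simps hmap_simps vmap_simps star_simps star_vid star_vcomp
    fold_cell_simps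
  have id: "fold_cell (hcell k) = hcell k" if "k \<in> H" for k
    using that by (auto intro!: fold_cell_id simp: hmap_simps endo_simps)
  have "hcell h \<star>\<^sub>v (vsq w \<star>\<^sub>h a) = (a \<star>\<^sub>h vsq w') \<star>\<^sub>v hcell h'
    \<longleftrightarrow> fold_cell (hcell h \<star>\<^sub>v (vsq w \<star>\<^sub>h a)) = fold_cell ((a \<star>\<^sub>h vsq w') \<star>\<^sub>v hcell h')"
    by (auto intro: fold_cell_inj simp: s unit_simps)
  also have "\<dots> \<longleftrightarrow> ((sqvid D (onVer \<Lambda> (vund w)) \<star>\<^sub>h hcell h)
        \<star>\<^sub>v (fold_cell (vsq w) \<star>\<^sub>h sqvid D (hund h)))
        \<star>\<^sub>v (sqvid D (emor (p (vtgt w))) \<star>\<^sub>h fold_cell a)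
      = (fold_cell a \<star>\<^sub>h sqvid D (emor (p (vsrc w'))))
        \<star>\<^sub>v ((sqvid D (hund h') \<star>\<^sub>h fold_cell (vsq w'))
        \<star>\<^sub>v (hcell h' \<star>\<^sub>h sqvid D (onVer \<Lambda> (vund w'))))"
    by (simp add: s id fold_cell_vcomp fold_cell_hcomp sqvid_hid_unit unit_simps sqv.comp_assoc
        hor.comp_assoc)
  finally show ?thesis
    unfolding endo_squares_def endo_cells_def
    by (simp add: assms Cell2_HD hm.comp_closed hmap_of_V)
      (simp add: s corner_simps)
qed

end

section \<open>Free monads\<close>

lemma End2_simps [simp]:
  "Cell0 (End2 K) = endos K" "Cell1 (End2 K) = endo_hmaps K id (endos K)"
  "Cell2 (End2 K) = endo_cells K id (endo_hmaps K id (endos K))"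
  "dom1 (End2 K) = hsrc" "cod1 (End2 K) = htgt" "src2 (End2 K) = csrc" "tgt2 (End2 K) = ctgt"
  "id1 (End2 K) = hmap_id K id" "id2 (End2 K) = (\<lambda>h. MapCell h h (id2 K (hund h)))"
  "comp1 (End2 K) = hmap_comp K"
  "hcomp2 (End2 K) = (\<lambda>a b. MapCell (hmap_comp K (csrc a) (csrc b)) (hmap_comp K (ctgt a) (ctgt b))
     (cund a \<star>\<^bsub>K\<^esub> cund b))"
  by (simp_all add: End2_def endo_two_category_on_def)

lemma Mnd2_simps [simp]:
  "Cell0 (Mnd2 K) = monads K" "Cell1 (Mnd2 K) = monad_hmaps K"
  "Cell2 (Mnd2 K) = endo_cells K endo_of (monad_hmaps K)"
  "dom1 (Mnd2 K) = hsrc" "cod1 (Mnd2 K) = htgt" "src2 (Mnd2 K) = csrc" "tgt2 (Mnd2 K) = ctgt"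
  "id1 (Mnd2 K) = hmap_id K endo_of" "id2 (Mnd2 K) = (\<lambda>h. MapCell h h (id2 K (hund h)))"
  "comp1 (Mnd2 K) = hmap_comp K"
  "hcomp2 (Mnd2 K) = (\<lambda>a b. MapCell (hmap_comp K (csrc a) (csrc b)) (hmap_comp K (ctgt a) (ctgt b))
     (cund a \<star>\<^bsub>K\<^esub> cund b))"
  by (simp_all add: Mnd2_def endo_two_category_on_def)

lemma forget_simps [simp]:
  "on0 forget2 = endo_of" "on1 forget2 = map_hmap endo_of id id"
  "on2 forget2 = map_mapcell (map_hmap endo_of id id) id"
  "onOb forgetD = endo_of" "onHor forgetD = map_hmap endo_of id id"
  "onVer forgetD = map_vmap endo_of id id"
  "onSq forgetD = map_framed (map_hmap endo_of id id) (map_vmap endo_of id id) id"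
  by (simp_all add: forget2_def forgetD_def)

lemma twofun_simps [simp]:
  "on0 twofun_id = id" "on1 twofun_id = id" "on2 twofun_id = id"
  "on0 (twofun_comp G F) = on0 G \<circ> on0 F" "on1 (twofun_comp G F) = on1 G \<circ> on1 F"
  "on2 (twofun_comp G F) = on2 G \<circ> on2 F"
  by (simp_all add: twofun_id_def twofun_comp_def)

lemma EndD_eq:
  "EndD D = endo_double_category_on D id (endos (horizontal_two_category D))
     (endo_hmaps (horizontal_two_category D) id (endos (horizontal_two_category D)))
     (endo_vmaps D id (endos (horizontal_two_category D)))"
  by (simp add: EndD_def Let_def)

lemma MndD_eq:
  "MndD D = endo_double_category_on D endo_of (monads (horizontal_two_category D))
     (monad_hmaps (horizontal_two_category D)) (monad_vmaps D)"
  by (simp add: MndD_def Let_def)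

locale cofolding_free_monads =
  cofolding D \<Lambda> +
  adj: two_adjunction "Mnd2 (horizontal_two_category D)" "End2 (horizontal_two_category D)" forget2 R \<eta> \<epsilon>
  for D :: "('o, 'h, 'v, 's) dblcat" (structure) and \<Lambda> R \<eta> \<epsilon> +
  assumes hund_counit: "A \<in> endos (horizontal_two_category D) \<Longrightarrow> hund (\<epsilon> A) = hid D (eob A)"
begin

abbreviation K where "K \<equiv> source.HD"

sublocale E: endo_structures D id "endos K" "endo_hmaps K id (endos K)" "endo_vmaps D id (endos K)"
  by (rule source.End_structures) (rule adj.left_adjoint.target.two_category_axioms)

sublocale M: endo_structures D endo_of "monads K" "monad_hmaps K" "monad_vmaps D"
  by (rule source.Mnd_structures) (rule adj.left_adjoint.source.two_category_axioms)

sublocale E: cofolded_endo_structures D id "endos K" "endo_hmaps K id (endos K)"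
    "endo_vmaps D id (endos K)" \<Lambda>
  by unfold_locales (simp add: hmap_of_closed E.vmap_simps)

sublocale M: cofolded_endo_structures D endo_of "monads K" "monad_hmaps K" "monad_vmaps D" \<Lambda>
  by unfold_locales (simp add: hmap_of_monad M.vmaps)

abbreviation R0 where "R0 \<equiv> on0 R"
abbreviation R1 where "R1 \<equiv> on1 R"
abbreviation U1 where "U1 \<equiv> map_hmap endo_of id id"

section \<open>Underlying data of the 2-adjunction\<close>

lemma U1_closed: "h \<in> monad_hmaps K \<Longrightarrow> U1 h \<in> endo_hmaps K id (endos K)"
  using adj.left_adjoint.on1_closed by simp

lemma U1_sel [simp]:
  "hsrc (U1 h) = endo_of (hsrc h)" "htgt (U1 h) = endo_of (htgt h)" "hund (U1 h) = hund h"
  "hcell (U1 h) = hcell h"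
  by (simp_all add: hmap.map_sel)

lemma U1_comp: "U1 (hmap_comp K h h') = hmap_comp K (U1 h) (U1 h')"
  by (simp add: hmap_comp_def)

lemma U1_id: "U1 (hmap_id K endo_of B) = hmap_id K id (endo_of B)"
  by (simp add: hmap_id_def)

lemma R_simps:
  "A \<in> endos K \<Longrightarrow> R0 A \<in> monads K"
  "h \<in> endo_hmaps K id (endos K) \<Longrightarrow> R1 h \<in> monad_hmaps K"
  "h \<in> endo_hmaps K id (endos K) \<Longrightarrow> hsrc (R1 h) = R0 (hsrc h)"
  "h \<in> endo_hmaps K id (endos K) \<Longrightarrow> htgt (R1 h) = R0 (htgt h)"
  using adj.right_adjoint.on0_closed adj.right_adjoint.on1_closed adj.right_adjoint.dom1_on1
    adj.right_adjoint.cod1_on1 by simp_all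

lemma R1_comp:
  "\<lbrakk>h \<in> endo_hmaps K id (endos K); h' \<in> endo_hmaps K id (endos K); htgt h = hsrc h'\<rbrakk>
    \<Longrightarrow> R1 (hmap_comp K h h') = hmap_comp K (R1 h) (R1 h')"
  using adj.right_adjoint.on1_comp1[of h h'] by simp

lemma R1_id: "A \<in> endos K \<Longrightarrow> R1 (hmap_id K id A) = hmap_id K endo_of (R0 A)"
  using adj.right_adjoint.on1_id1[of A] by simp

lemma eps_simps:
  assumes "A \<in> endos K"
  shows "\<epsilon> A \<in> endo_hmaps K id (endos K)" "hsrc (\<epsilon> A) = endo_of (R0 A)" "htgt (\<epsilon> A) = A"
  using adj.counit.component_closed[of A] adj.counit.dom1_component[of A]
    adj.counit.cod1_component[of A] assms by simp_all

lemma eta_simps: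
  assumes "B \<in> monads K"
  shows "\<eta> B \<in> monad_hmaps K" "hsrc (\<eta> B) = B" "htgt (\<eta> B) = R0 (endo_of B)"
  using adj.unit.component_closed[of B] adj.unit.dom1_component[of B]
    adj.unit.cod1_component[of B] assms by simp_all

lemma eob_R0: "A \<in> endos K \<Longrightarrow> eob (endo_of (R0 A)) = eob A"
  using E.hmap_simps(4)[OF eps_simps(1), of A] E.endo_simps[of A]
  by (simp add: eps_simps hund_counit source.closure_simps)

lemma eps_natural:
  "h \<in> endo_hmaps K id (endos K)
    \<Longrightarrow> hmap_comp K (U1 (R1 h)) (\<epsilon> (htgt h)) = hmap_comp K (\<epsilon> (hsrc h)) h"
  using adj.counit.natural1[of h] by simp

lemma eta_natural:
  "h \<in> monad_hmaps K \<Longrightarrow> hmap_comp K h (\<eta> (htgt h)) = hmap_comp K (\<eta> (hsrc h)) (R1 (U1 h))"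
  using adj.unit.natural1[of h] by simp

lemmas simps = source.closure_simps E.endo_simps[simplified] M.endo_simps
  E.hmap_simps[simplified] M.hmap_simps U1_closed M.endos
  R_simps eps_simps eta_simps eob_R0 hund_counit

text \<open>In the naturality square of the counit, both counit components are carried by
  identities.\<close>

lemma hund_R1:
  assumes "h \<in> endo_hmaps K id (endos K)"
  shows "hund (R1 h) = hund h"
  using arg_cong[OF eps_natural[OF assms], of hund] assms M.hmap_simps(3-5)[OF R_simps(2)[OF assms]]
  by (simp add: simps source.unit_simps)

text \<open>In the triangle identity at \<open>B\<close> the counit component is carried by an
  identity, hence so is the unit component.\<close>

lemma hund_eta:
  assumes "B \<in> monads K"
  shows "hund (\<eta> B) = hid D (eob (endo_of B))"
  using arg_cong[OF adj.triangle_left[of B], of hund] assms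
    M.hmap_simps(3-5)[OF eta_simps(1)[OF assms]]
  by (simp add: simps source.unit_simps)

text \<open>Naturality of the counit for 2-cells involves whiskering with identities only. This is
  why a square of \<open>D\<close> can later serve as its own transpose.\<close>

lemma cund_on2:
  assumes "b \<in> endo_cells K id (endo_hmaps K id (endos K))"
  shows "cund (on2 R b) = cund b"
proof -
  have b: "csrc b \<in> endo_hmaps K id (endos K)" "ctgt b \<in> endo_hmaps K id (endos K)"
    "hsrc (csrc b) = hsrc (ctgt b)" "htgt (csrc b) = htgt (ctgt b)"
    "cund b \<in> Cell2 K" "sqtop D (cund b) = hund (csrc b)" "sqbot D (cund b) = hund (ctgt b)"
    using assms by (auto simp: endo_cells_def)
  have "on2 R b \<in> endo_cells K endo_of (monad_hmaps K)"
    "csrc (on2 R b) = R1 (csrc b)" "ctgt (on2 R b) = R1 (ctgt b)"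
    using adj.right_adjoint.on2_closed[of b] adj.right_adjoint.src2_on2[of b]
      adj.right_adjoint.tgt2_on2[of b] assms by simp_all
  then have r: "cund (on2 R b) \<in> Cell2 K" "sqtop D (cund (on2 R b)) = hund (R1 (csrc b))"
    by (auto simp: endo_cells_def)
  have "cund (on2 R b) \<star>\<^sub>h sqvid D (hund (\<epsilon> (htgt (csrc b))))
      = sqvid D (hund (\<epsilon> (hsrc (csrc b)))) \<star>\<^sub>h cund b"
    using arg_cong[OF adj.counit.natural2[of b], of cund] assms by (simp add: mapcell.map_sel)
  then show ?thesis
    using b r by (simp add: simps hund_R1 source.Cell2_HD source.sqvid_hid_unit)
qed

section \<open>Transposition across the 2-adjunction\<close>

definition transpose :: "('o, 'h, 's) monad \<Rightarrow> (('o, 'h) endo, 'h, 's) hmap \<Rightarrow> _" where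
  "transpose B h = hmap_comp K (\<eta> B) (R1 h)"

lemma
  assumes "B \<in> monads K" "h \<in> endo_hmaps K id (endos K)" "hsrc h = endo_of B"
  shows transpose_closed: "transpose B h \<in> monad_hmaps K"
    and hsrc_transpose: "hsrc (transpose B h) = B"
    and htgt_transpose: "htgt (transpose B h) = R0 (htgt h)"
    and hund_transpose: "hund (transpose B h) = hund h"
    and transpose_eps: "hmap_comp K (U1 (transpose B h)) (\<epsilon> (htgt h)) = h"
proof -
  show "transpose B h \<in> monad_hmaps K" "hsrc (transpose B h) = B"
    "htgt (transpose B h) = R0 (htgt h)" "hund (transpose B h) = hund h"
    using assms unfolding transpose_def
    by (simp_all add: simps M.hm.comp_closed hund_eta hund_R1 source.unit_simps)
  have "hmap_comp K (U1 (transpose B h)) (\<epsilon> (htgt h))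
      = hmap_comp K (U1 (\<eta> B)) (hmap_comp K (U1 (R1 h)) (\<epsilon> (htgt h)))"
    using assms unfolding transpose_def by (simp add: simps U1_comp E.hm.comp_assoc)
  also have "\<dots> = hmap_comp K (hmap_comp K (U1 (\<eta> B)) (\<epsilon> (endo_of B))) h"
    using assms by (simp add: simps eps_natural E.hm.comp_assoc)
  also have "\<dots> = h"
    using assms adj.triangle_left[of B] by (simp add: simps E.hmap_unit)
  finally show "hmap_comp K (U1 (transpose B h)) (\<epsilon> (htgt h)) = h" .
qed

lemma transpose_unique:
  assumes "t \<in> monad_hmaps K" "htgt t = R0 A" "A \<in> endos K"
  shows "transpose (hsrc t) (hmap_comp K (U1 t) (\<epsilon> A)) = t"
proof -
  have "transpose (hsrc t) (hmap_comp K (U1 t) (\<epsilon> A))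
      = hmap_comp K (hmap_comp K (\<eta> (hsrc t)) (R1 (U1 t))) (R1 (\<epsilon> A))"
    using assms unfolding transpose_def by (simp add: simps R1_comp M.hm.comp_assoc)
  also have "\<dots> = hmap_comp K t (hmap_comp K (\<eta> (R0 A)) (R1 (\<epsilon> A)))"
    using assms eta_natural[of t] by (simp add: simps M.hm.comp_assoc[symmetric])
  also have "\<dots> = t"
    using assms adj.triangle_right[of A] by (simp add: M.hmap_unit)
  finally show ?thesis .
qed

lemma transpose_precomp:
  assumes "B \<in> monads K" "h \<in> endo_hmaps K id (endos K)" "hsrc h = endo_of B"
    and "f \<in> endo_hmaps K id (endos K)" "htgt h = hsrc f"
  shows "transpose B (hmap_comp K h f) = hmap_comp K (transpose B h) (R1 f)"
  using assms unfolding transpose_def by (simp add: simps R1_comp M.hm.comp_assoc)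

text \<open>Naturality of the unit at \<open>k\<close>. For the boundary of a square this treats the
  path through the bottom, and \<open>transpose_precomp\<close> the path through the top.\<close>

lemma transpose_postcomp:
  assumes "k \<in> monad_hmaps K" "h \<in> endo_hmaps K id (endos K)" "hsrc h = endo_of (htgt k)"
  shows "transpose (hsrc k) (hmap_comp K (U1 k) h) = hmap_comp K k (transpose (htgt k) h)"
proof -
  have "transpose (hsrc k) (hmap_comp K (U1 k) h)
      = hmap_comp K (hmap_comp K (\<eta> (hsrc k)) (R1 (U1 k))) (R1 h)"
    using assms unfolding transpose_def by (simp add: simps R1_comp M.hm.comp_assoc)
  also have "\<dots> = hmap_comp K k (transpose (htgt k) h)"
    using assms eta_natural[of k] unfolding transpose_def
    by (simp add: simps M.hm.comp_assoc[symmetric])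
  finally show ?thesis .
qed

text \<open>The transpose is the image of the 2-cell under \<open>R\<close>, whiskered with
  \<open>\<eta> B\<close>; both operations keep the underlying cell, so \<open>c\<close> is
  unchanged.\<close>

lemma transpose_cell:
  assumes "MapCell h h' c \<in> endo_cells K id (endo_hmaps K id (endos K))"
    and "B \<in> monads K" "hsrc h = endo_of B"
  shows "MapCell (transpose B h) (transpose B h') c \<in> endo_cells K endo_of (monad_hmaps K)"
proof -
  let ?b = "MapCell h h' c"
  have b: "h \<in> endo_hmaps K id (endos K)" "h' \<in> endo_hmaps K id (endos K)"
    "hsrc h' = endo_of B" "c \<in> Cell2 K" "sqtop D c = hund h"
    using assms by (auto simp: endo_cells_def)
  have r: "on2 R ?b \<in> endo_cells K endo_of (monad_hmaps K)"
    "csrc (on2 R ?b) = R1 h" "ctgt (on2 R ?b) = R1 h'"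
    using adj.right_adjoint.on2_closed[of ?b] adj.right_adjoint.src2_on2[of ?b]
      adj.right_adjoint.tgt2_on2[of ?b] assms(1) by simp_all
  \<comment> \<open>Closure of the cells under whiskering is taken from the 2-category structure of
    \<open>Mnd2 K\<close>.\<close>
  interpret M2: category "monads K" "endo_cells K endo_of (monad_hmaps K)"
    "\<lambda>a. hsrc (csrc a)" "\<lambda>a. htgt (csrc a)" "\<lambda>A. id2 (Mnd2 K) (hmap_id K endo_of A)" "hcomp2 (Mnd2 K)"
    using adj.left_adjoint.source.hcat2 by simp
  interpret V2: category "monad_hmaps K" "endo_cells K endo_of (monad_hmaps K)"
    csrc ctgt "id2 (Mnd2 K)" "vcomp2 (Mnd2 K)"
    using adj.left_adjoint.source.vcat2 by simp
  have "hcomp2 (Mnd2 K) (id2 (Mnd2 K) (\<eta> B)) (on2 R ?b) \<in> endo_cells K endo_of (monad_hmaps K)"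
    using assms b r V2.ide_closed[of "\<eta> B"] by (intro M2.comp_closed) (simp_all add: simps)
  then show ?thesis
    using assms b r
    by (simp add: transpose_def cund_on2 hund_eta source.Cell2_HD source.sqvid_hid_unit simps)
qed

section \<open>The unit of the double adjunction\<close>

definition eta_ob :: "('o, 'h) endo \<Rightarrow> (('o, 'h) endo, 'v, 's) vmap" where
  "eta_ob A = VMap A (endo_of (R0 A)) (vid D (eob A)) (hcell (\<epsilon> A))"

definition eta_hor :: "(('o, 'h) endo, 'h, 's) hmap
    \<Rightarrow> ((('o, 'h) endo, 'h, 's) hmap, (('o, 'h) endo, 'v, 's) vmap, 's) framed" where
  "eta_hor f = Framed f (U1 (R1 f)) (eta_ob (hsrc f)) (eta_ob (htgt f)) (sqvid D (hund f))"

lemma eta_ob_sel [simp]: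
  "vsrc (eta_ob A) = A" "vtgt (eta_ob A) = endo_of (R0 A)" "vund (eta_ob A) = vid D (eob A)"
  "vsq (eta_ob A) = hcell (\<epsilon> A)"
  by (simp_all add: eta_ob_def)

text \<open>As \<open>hund (\<epsilon> A)\<close> is an identity, the composites bounding the cell
  of \<open>\<epsilon> A\<close> reduce to the endomorphisms \<open>emor A\<close> (top) and
  \<open>emor (endo_of (R0 A))\<close> (bottom).\<close>

lemma eta_ob_closed:
  assumes "A \<in> endos K"
  shows "eta_ob A \<in> endo_vmaps D id (endos K)"
  using assms E.hmap_simps[OF eps_simps(1)[OF assms]]
  by (simp add: endo_vmaps_def simps source.unit_simps)

lemma hmap_of_eta_ob:
  assumes "A \<in> endos K"
  shows "hmap_of (eta_ob A) = \<epsilon> A"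
  using assms E.hmap_simps[OF eps_simps(1)[OF assms]]
  by (intro hmap.expand) (simp add: simps star_vid fold_cell_id)

text \<open>An identity square fits since \<open>R1\<close> preserves underlying morphisms; the
  square condition is then the cell part of the naturality of \<epsilon>.\<close>

lemma eta_hor_closed:
  assumes f: "f \<in> endo_hmaps K id (endos K)"
  shows "eta_hor f \<in> endo_squares D (endo_hmaps K id (endos K)) (endo_vmaps D id (endos K))"
proof -
  have "hcell f \<star>\<^sub>v (hcell (\<epsilon> (hsrc f)) \<star>\<^sub>h sqvid D (hund f))
      = (sqvid D (hund f) \<star>\<^sub>h hcell (\<epsilon> (htgt f))) \<star>\<^sub>v hcell (R1 f)"
    using arg_cong[OF eps_natural[OF f], of hcell] f
    by (simp add: simps hund_R1 source.sqvid_hid_unit)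
  then show ?thesis
    unfolding endo_squares_def eta_hor_def using f
    by (simp add: simps eta_ob_closed hund_R1)
qed

section \<open>Universal property of the unit\<close>

lemma forget_vmap:
  assumes "t \<in> monad_vmaps D"
  shows "map_vmap endo_of id id t \<in> endo_vmaps D id (endos K)"
    and "hmap_of (map_vmap endo_of id id t) = U1 (hmap_of t)"
  using M.vmaps[OF assms] by (auto simp: endo_vmaps_def M.endos vmap.map_sel hmap_of_def)

text \<open>The transpose of \<open>hmap_of w\<close> is still carried by
  \<open>onVer \<Lambda> (vund w)\<close>, so it unfolds over \<open>vund w\<close>, and
  \<open>hmap_of_monad\<close> makes the result a monad map. The factorization is
  \<open>transpose_eps\<close> read back through folding.\<close>

lemma vmap_lift:
  assumes "w \<in> endo_vmaps D id (endos K)" "B \<in> monads K" "vtgt w = endo_of B"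
  obtains t where "t \<in> monad_vmaps D" "vsrc t = R0 (vsrc w)" "vtgt t = B" "vund t = vund w"
    "hmap_of t = transpose B (hmap_of w)"
    "vcomp (EndD D) (eta_ob (vsrc w)) (map_vmap endo_of id id t) = w"
proof -
  have w: "hmap_of w \<in> endo_hmaps K id (endos K)" "hsrc (hmap_of w) = endo_of B"
    using assms E.hmap_of_V by simp_all
  let ?h = "transpose B (hmap_of w)"
  note tr = transpose_closed[OF assms(2) w] hsrc_transpose[OF assms(2) w]
    htgt_transpose[OF assms(2) w] hund_transpose[OF assms(2) w]
  obtain t where t: "t \<in> endo_vmaps D endo_of (monads K)" "vund t = vund w" "hmap_of t = ?h"
    by (rule hmap_of_surj[of ?h endo_of "monads K" "vund w"])
      (use tr M.hmaps[OF tr(1)] assms in \<open>auto simp: simps E.vmap_simps[simplified]\<close>)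
  have tm: "t \<in> monad_vmaps D"
    using hmap_of_monad[OF t(1)] t(3) tr(1) by simp
  have st: "vsrc t = R0 (vsrc w)" "vtgt t = B"
    using arg_cong[OF t(3), of hsrc] arg_cong[OF t(3), of htgt] tr by simp_all
  let ?c = "vcomp (EndD D) (eta_ob (vsrc w)) (map_vmap endo_of id id t)"
  have A: "vsrc w \<in> endos K"
    using assms by (simp add: E.vmap_simps[simplified])
  have "?c = w"
  proof (rule hmap_of_inj)
    show "?c \<in> endo_vmaps D id (endos K)"
      using E.vmap_comp[OF eta_ob_closed[OF A] forget_vmap(1)[OF tm]] st
      by (simp add: EndD_eq vmap.map_sel)
    show "hmap_of ?c = hmap_of w"
      using hmap_of_vcomp[OF eta_ob_closed[OF A] forget_vmap(1)[OF tm]] st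
        forget_vmap(2)[OF tm] t(3) hmap_of_eta_ob[OF A] transpose_eps[OF assms(2) w]
      by (simp add: EndD_eq vmap.map_sel)
    show "vund ?c = vund w"
      using t(2) assms(1) A
      by (simp add: EndD_eq vmap.map_sel E.vmap_simps[simplified] source.unit_simps)
  qed fact
  then show thesis
    using that tm st t(2,3) by blast
qed

text \<open>The two conclusions match the premises of \<open>hmap_of_inj\<close>: one is uniqueness
  of transposes, the other holds because the unit is carried by a vertical identity.\<close>

lemma vmap_lift_unique:
  assumes "t \<in> monad_vmaps D" "vsrc t = R0 A" "A \<in> endos K"
    and "vcomp (EndD D) (eta_ob A) (map_vmap endo_of id id t) = w"
  shows "hmap_of t = transpose (vtgt t) (hmap_of w)" "vund t = vund w"
proof -
  have "hmap_of w = hmap_comp K (U1 (hmap_of t)) (\<epsilon> A)"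
    using hmap_of_vcomp[OF eta_ob_closed[OF assms(3)] forget_vmap(1)[OF assms(1)]] assms(2)
      forget_vmap(2)[OF assms(1)] hmap_of_eta_ob[OF assms(3)] assms(4)[symmetric]
    by (simp add: EndD_eq vmap.map_sel)
  then show "hmap_of t = transpose (vtgt t) (hmap_of w)"
    using transpose_unique[of "hmap_of t" A] M.hmap_of_V[OF assms(1)] assms by simp
  show "vund t = vund w"
    using assms(4)[symmetric] M.vmap_simps[OF assms(1)] assms(2,3)
    by (simp add: EndD_eq vmap.map_sel simps source.unit_simps)
qed

lemma vmap_lift_eq:
  assumes "s \<in> monad_vmaps D" "t \<in> monad_vmaps D" "vsrc s = R0 A" "vsrc t = R0 A" "A \<in> endos K"
    and "vtgt s = vtgt t"
    and "vcomp (EndD D) (eta_ob A) (map_vmap endo_of id id s)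
      = vcomp (EndD D) (eta_ob A) (map_vmap endo_of id id t)"
  shows "s = t"
  using vmap_lift_unique[OF assms(1,3,5,7)] vmap_lift_unique[OF assms(2,4,5) refl] assms(6)
  by (intro hmap_of_inj[OF M.vmaps[OF assms(1)] M.vmaps[OF assms(2)]]) simp_all

text \<open>The cell of \<open>eta_hor\<close> is an identity square, so the factor must have the
  cell of \<open>a\<close> itself; its sides are the lifts of the sides of \<open>a\<close>. It is a
  monad square by folding, transposing the 2-cell and unfolding again.\<close>

lemma square_lift:
  assumes a: "a \<in> endo_squares D (endo_hmaps K id (endos K)) (endo_vmaps D id (endos K))"
    and k: "k \<in> monad_hmaps K" "fbot a = U1 k"
  shows "\<exists>!t. t \<in> endo_squares D (monad_hmaps K) (monad_vmaps D) \<and> ftop t = R1 (ftop a) \<and> fbot t = k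
    \<and> sqvcomp (EndD D) (eta_hor (ftop a))
        (map_framed (map_hmap endo_of id id) (map_vmap endo_of id id) id t) = a"
    (is "\<exists>!t. ?P t")
proof -
  note a' = E.square_simps[OF a]
  have B: "hsrc k \<in> monads K" "htgt k \<in> monads K"
    "vtgt (fleft a) = endo_of (hsrc k)" "vtgt (fright a) = endo_of (htgt k)"
    using a'(7,8) k by (simp_all add: simps)
  obtain l where l: "l \<in> monad_vmaps D" "vsrc l = R0 (vsrc (fleft a))" "vtgt l = hsrc k"
    "vund l = vund (fleft a)" "hmap_of l = transpose (hsrc k) (hmap_of (fleft a))"
    "vcomp (EndD D) (eta_ob (vsrc (fleft a))) (map_vmap endo_of id id l) = fleft a"
    by (rule vmap_lift[OF a'(3) B(1,3)])
  obtain r where r: "r \<in> monad_vmaps D" "vsrc r = R0 (vsrc (fright a))" "vtgt r = htgt k"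
    "vund r = vund (fright a)" "hmap_of r = transpose (htgt k) (hmap_of (fright a))"
    "vcomp (EndD D) (eta_ob (vsrc (fright a))) (map_vmap endo_of id id r) = fright a"
    by (rule vmap_lift[OF a'(4) B(2,4)])
  let ?t = "Framed (R1 (ftop a)) k l r (fcell a)"
  have "MapCell (hmap_comp K (hmap_of (fleft a)) (ftop a)) (hmap_comp K (fbot a) (hmap_of (fright a)))
      (fold_cell (fcell a)) \<in> endo_cells K id (endo_hmaps K id (endos K))"
    using E.square_iff[of "ftop a" "fbot a" "fleft a" "fright a" "fcell a"] a a' by simp
  \<comment> \<open>The transposed composites are again composites around a boundary, now with
    vertical sides \<open>l\<close> and \<open>r\<close>.\<close>
  from transpose_cell[OF this[unfolded k(2)] B(1)]
  have "MapCell (hmap_comp K (hmap_of l) (R1 (ftop a))) (hmap_comp K k (hmap_of r))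
      (fold_cell (fcell a)) \<in> endo_cells K endo_of (monad_hmaps K)"
    using a' B k E.hmap_of_V
    by (simp add: l(5) r(5) transpose_precomp transpose_postcomp)
  then have t: "?t \<in> endo_squares D (monad_hmaps K) (monad_vmaps D)"
    using a' k l r
    by (subst M.square_iff) (simp_all add: R_simps hund_R1)
  have "?P ?t"
    using t a' l(6) r(6) k
    by (simp add: EndD_eq eta_hor_def framed.expand source.unit_simps vmap.map_sel)
  moreover have "t = ?t" if "?P t" for t
  proof -
    have t: "t \<in> endo_squares D (monad_hmaps K) (monad_vmaps D)" "ftop t = R1 (ftop a)" "fbot t = k"
      using that by simp_all
    note t' = M.square_simps[OF t(1)]
    have e: "sqvcomp (EndD D) (eta_hor (ftop a))
        (map_framed (map_hmap endo_of id id) (map_vmap endo_of id id) id t) = a"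
      using that by simp
    have "fcell t = fcell a"
      using arg_cong[OF e, of fcell] t' t(2) a'
      by (simp add: EndD_eq eta_hor_def framed.map_sel source.unit_simps hund_R1)
    moreover have "fleft t = l"
      by (rule vmap_lift_eq[where A = "vsrc (fleft a)"])
        (use arg_cong[OF e, of fleft] t' t l a' in
          \<open>simp_all add: EndD_eq eta_hor_def framed.map_sel R_simps E.vmap_simps[simplified]\<close>)
    moreover have "fright t = r"
      by (rule vmap_lift_eq[where A = "vsrc (fright a)"])
        (use arg_cong[OF e, of fright] t' t r a' in
          \<open>simp_all add: EndD_eq eta_hor_def framed.map_sel R_simps E.vmap_simps[simplified]\<close>)
    ultimately show "t = ?t"
      using t by (simp add: framed.expand)
  qed
  ultimately show ?thesis
    by blast
qed

definition unit where
  "unit = \<lparr>compOb = eta_ob, compHor = eta_hor\<rparr>"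

text \<open>Compatibility of the unit with horizontal composition reduces to that of
  \<open>R1\<close> and of vertical identity squares.\<close>

sublocale double_universal_arrows "MndD D" "EndD D" forgetD R0 R1 unit
proof (intro double_universal_arrows.intro double_universal_arrows_axioms.intro)
  show "double_functor (MndD D) (EndD D) forgetD"
    by (intro source.forgetD_functor adj.left_adjoint.target.two_category_axioms
        adj.left_adjoint.source.two_category_axioms)
next
  fix w B
  assume w: "w \<in> Ver (EndD D)" and B: "B \<in> Ob (MndD D)" and wB: "vcod (EndD D) w = onOb forgetD B"
  have dom: "vdom (EndD D) w = vsrc w" and A: "vsrc w \<in> endos K"
    using w by (simp_all add: EndD_eq E.vmap_simps[simplified])
  obtain t where "t \<in> monad_vmaps D" "vsrc t = R0 (vsrc w)" "vtgt t = B"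
    "vcomp (EndD D) (eta_ob (vsrc w)) (map_vmap endo_of id id t) = w"
    using vmap_lift[of w B] w B wB by (auto simp: EndD_eq MndD_eq)
  then show "\<exists>!t. t \<in> Ver (MndD D) \<and> vdom (MndD D) t = R0 (vdom (EndD D) w)
      \<and> vcod (MndD D) t = B \<and> compOb unit (vdom (EndD D) w) \<cdot>\<^sub>v\<^bsub>EndD D\<^esub> onVer forgetD t = w"
    unfolding dom by (intro ex1I[of _ t])
      (auto simp: unit_def MndD_eq intro: vmap_lift_eq[where A = "vsrc w"] A)
next
  fix a k
  assume "a \<in> Sq (EndD D)" "k \<in> Hor (MndD D)" "sqbot (EndD D) a = onHor forgetD k"
  then show "\<exists>!t. t \<in> Sq (MndD D) \<and> sqtop (MndD D) t = R1 (sqtop (EndD D) a)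
      \<and> sqbot (MndD D) t = k
      \<and> compHor unit (sqtop (EndD D) a) \<star>\<^sub>v\<^bsub>EndD D\<^esub> onSq forgetD t = a"
    using square_lift[of a k] by (simp add: EndD_eq MndD_eq unit_def)
qed (simp_all add: EndD_eq MndD_eq unit_def simps eta_ob_closed eta_hor_closed[unfolded eta_hor_def] eta_hor_def
      U1_comp U1_id R1_comp R1_id source.sqhid_vid source.sqvid_hcomp)

end

theorem theorem9p6:
  fixes D :: "('o, 'h, 'v, 's) dblcat"
    and \<Lambda> :: "('o, 'h, 'v, 's, 'o, 'h, 'h, ('h, 'h, 's) framed) dblfun"
  assumes "double_category D"
    and "cofolding D \<Lambda>"
    and "two_category_admits_free_monads (horizontal_two_category D)"
  shows "double_category_admits_free_monads D"
proof -
  interpret double_category D by fact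
  obtain R \<eta> \<epsilon> where "two_adjunction (Mnd2 HD) (End2 HD) forget2 R \<eta> \<epsilon>"
    and "\<forall>e \<in> endos HD. hund (\<epsilon> e) = id1 HD (eob e)"
    using assms(3) unfolding two_category_admits_free_monads_def by blast
  then interpret cofolding_free_monads D \<Lambda> R \<eta> \<epsilon>
    using assms(2) by (intro cofolding_free_monads.intro cofolding_free_monads_axioms.intro) simp_all
  show ?thesis
    \<comment> \<open>The unit of this adjunction has components \<open>eta_ob\<close>, carried by
      vertical identities by construction.\<close>
    unfolding double_category_admits_free_monads_def
    using vertical_adjunction by (auto simp: unit_def EndD_eq intro!: exI)
qed

end
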